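(* Let $q(\bm{x},\bm{f})=p(\bm{f}_{\neq u}\mid\bm{u})\,q(\bm{x},\bm{u})$ with $q(\bm{x},\bm{u})$ Gaussian, and let $\bm{u}=(u_{\mathrm{d}},\bm{u}_{\mathrm{l}})$, where $u_{\mathrm{d}}$ is an inducing point to be discarded and $\bm{u}_{\mathrm{l}}$ are the remaining inducing points. Among all distributions of the form $\hat{q}(\bm{x},\bm{f})=p(\bm{f}_{\neq u_{\mathrm{l}}}\mid\bm{u}_{\mathrm{l}})\,\hat{q}(\bm{x},\bm{u}_{\mathrm{l}})$ with $\hat{q}(\bm{x},\bm{u}_{\mathrm{l}})$ Gaussian, the inclusive Kullback–Leibler divergence $\mathrm{KL}[q(\bm{x},\bm{f})\,\|\,\hat{q}(\bm{x},\bm{f})]$ is minimized by the marginal of $q(\bm{x},\bm{u})$ obtained by integrating out the discarded point: $$\hat{q}^*(\bm{x},\bm{u}_{\mathrm{l}})=\arg\min_{\hat{q}(\bm{x},\bm{u}_{\mathrm{l}})}\mathrm{KL}\left[q(\bm{x},\bm{f})\,\|\,\hat{q}(\bm{x},\bm{f})\right]=\int q(\bm{x},\bm{u})\,du_{\mathrm{d}}.$$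
   Context: $f:\mathbb{R}^{d_x}\to\mathbb{R}$ has a zero-mean Gaussian process prior with kernel $K_0$, for which kernel matrices at finitely many distinct inputs are invertible. $\bm{f}=\{f(\bm{x}):\bm{x}\in\mathbb{R}^{d_x}\}$ denotes all function values, and laws of $\bm{f}$ are laws of processes. $\bm{u}=\{f(\bm{x}_i)\}_{i=1}^{n_u}$ is a finite set of function values at distinct inputs (inducing points). $\bm{x}\in\mathbb{R}^{d_x}$ is the system state, a random vector jointly distributed with $\bm{f}$. $q(\bm{x},\bm{u})$ is a Gaussian density. For a finite set $\bm{v}$ of function values, $\bm{f}_{\neq v}=\bm{f}\setminus\bm{v}$, and $p(\bm{f}_{\neq v}\mid\bm{v})$ is the conditional distribution under the GP prior, $\mathcal{N}(\bm{K}_{f_{\neq v}v}\bm{K}_{vv}^{-1}\bm{v},\ \bm{K}_{f_{\neq v}f_{\neq v}}-\bm{K}_{f_{\neq v}v}\bm{K}_{vv}^{-1}\bm{K}_{vf_{\neq v}})$, where $\bm{K}_{ab}$ is the matrix of prior covariances between the collections of function values $a$ and $b$. $\mathrm{KL}[q\,\|\,\hat{q}]=\int q\log(q/\hat{q})$. *)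

theory Defs
  imports "HOL-Probability.Probability" "Jordan_Normal_Form.Determinant"
begin

text \<open>
  A finite family of distinct indices (inputs) is a distinct list; an assignment of values to the
  family \<open>js\<close> is a point of the product space over \<open>set js\<close>. Lists only serve to write down matrices:
  none of the laws below depends on the order of the list.
\<close>

definition cov_mat :: "('i \<Rightarrow> 'i \<Rightarrow> real) \<Rightarrow> 'i list \<Rightarrow> 'i list \<Rightarrow> real mat" where
  "cov_mat S is js = Matrix.mat (length is) (length js) (\<lambda>(a, b). S (is ! a) (js ! b))"

definition val_vec :: "('i \<Rightarrow> real) \<Rightarrow> 'i list \<Rightarrow> real Matrix.vec" where
  "val_vec z js = Matrix.vec (length js) (\<lambda>a. z (js ! a))"

definition inv_mat :: "real mat \<Rightarrow> real mat" where
  "inv_mat A = (THE B. inverts_mat A B \<and> inverts_mat B A)"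

definition sym_psd :: "real mat \<Rightarrow> bool" where
  "sym_psd A \<longleftrightarrow> square_mat A \<and> transpose_mat A = A \<and>
     (\<forall>c \<in> carrier_vec (dim_row A). 0 \<le> scalar_prod c (A *\<^sub>v c))"

definition covariance_kernel :: "('i \<Rightarrow> 'i \<Rightarrow> real) \<Rightarrow> bool" where
  "covariance_kernel K \<longleftrightarrow> (\<forall>xs. sym_psd (cov_mat K xs xs))"

definition gaussian_density ::
    "'i list \<Rightarrow> ('i \<Rightarrow> real) \<Rightarrow> ('i \<Rightarrow> 'i \<Rightarrow> real) \<Rightarrow> ('i \<Rightarrow> real) \<Rightarrow> real" where
  "gaussian_density js m S z =
     (let \<Sigma> = cov_mat S js js; y = val_vec z js - val_vec m js
      in exp (- scalar_prod y (inv_mat \<Sigma> *\<^sub>v y) / 2)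
           / sqrt ((2 * pi) ^ length js * Determinant.det \<Sigma>))"

text \<open>
  Laws of Gaussian processes indexed by \<open>I\<close>, via their finite-dimensional distributions. Only
  covariances that are invertible on finite sets of distinct indices occur here, so these
  distributions all have densities.
\<close>

definition gaussian_process ::
    "'i set \<Rightarrow> ('i \<Rightarrow> real) \<Rightarrow> ('i \<Rightarrow> 'i \<Rightarrow> real) \<Rightarrow> ('i \<Rightarrow> real) measure \<Rightarrow> bool" where
  "gaussian_process I m S P \<longleftrightarrow>
     prob_space P \<and> sets P = sets (PiM I (\<lambda>_. borel)) \<and>
     (\<forall>js. distinct js \<and> set js \<subseteq> I \<longrightarrow>
        distr P (PiM (set js) (\<lambda>_. borel)) (\<lambda>f. restrict f (set js)) =
        density (PiM (set js) (\<lambda>_. lborel)) (\<lambda>z. ennreal (gaussian_density js m S z)))"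

definition cond_mean :: "('i \<Rightarrow> 'i \<Rightarrow> real) \<Rightarrow> 'i list \<Rightarrow> ('i \<Rightarrow> real) \<Rightarrow> 'i \<Rightarrow> real" where
  "cond_mean K vs v s =
     vec_index (cov_mat K [s] vs * inv_mat (cov_mat K vs vs) *\<^sub>v val_vec v vs) 0"

definition cond_cov :: "('i \<Rightarrow> 'i \<Rightarrow> real) \<Rightarrow> 'i list \<Rightarrow> 'i \<Rightarrow> 'i \<Rightarrow> real" where
  "cond_cov K vs s t =
     K s t - (cov_mat K [s] vs * inv_mat (cov_mat K vs vs) * cov_mat K vs [t]) $$ (0, 0)"

text \<open>
  The law of the function values outside \<open>set vs\<close> given the values \<open>v\<close> at \<open>vs\<close>. A probability
  measure on the product space is determined by its finite-dimensional distributions, whence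
  \<open>THE\<close>.
\<close>

definition gp_conditional ::
    "('i \<Rightarrow> 'i \<Rightarrow> real) \<Rightarrow> 'i list \<Rightarrow> ('i \<Rightarrow> real) \<Rightarrow> ('i \<Rightarrow> real) measure" where
  "gp_conditional K vs v =
     (THE P. gaussian_process (- set vs) (cond_mean K vs v) (cond_cov K vs) P)"

text \<open>
  Nondegenerate Gaussian densities in the pair of a state \<open>x\<close> and the function values \<open>v\<close> at \<open>vs\<close>.
  The coordinates of \<open>x\<close> are indexed by \<open>Inl\<close>, those of \<open>v\<close> by \<open>Inr\<close>.
\<close>

definition is_gaussian :: "(real ^ 'd) list \<Rightarrow> ((real ^ 'd) \<times> (real ^ 'd \<Rightarrow> real) \<Rightarrow> real) \<Rightarrow> bool" where
  "is_gaussian vs q \<longleftrightarrow>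
     (\<exists>js m S. distinct js \<and> set js = range Inl \<union> Inr ` set vs \<and>
        sym_psd (cov_mat S js js) \<and> invertible_mat (cov_mat S js js) \<and>
        q = (\<lambda>(x, v). gaussian_density js m S (case_sum (\<lambda>i. vec_nth x i) v)))"

text \<open>
  The law of the state and all function values with density \<open>q\<close> for the state and the values at
  \<open>vs\<close>, and with the remaining values drawn from the conditional prior given those at \<open>vs\<close>.
\<close>

definition joint_law ::
    "(real ^ 'd \<Rightarrow> real ^ 'd \<Rightarrow> real) \<Rightarrow> (real ^ 'd) list \<Rightarrow>
     ((real ^ 'd) \<times> (real ^ 'd \<Rightarrow> real) \<Rightarrow> real) \<Rightarrow> ((real ^ 'd) \<times> (real ^ 'd \<Rightarrow> real)) measure" where
  "joint_law K vs q =
     density (lborel \<Otimes>\<^sub>M PiM (set vs) (\<lambda>_. lborel)) (\<lambda>z. ennreal (q z)) \<bind>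
       (\<lambda>(x, v). distr (gp_conditional K vs v) (borel \<Otimes>\<^sub>M PiM UNIV (\<lambda>_. borel))
          (\<lambda>g. (x, merge (set vs) (- set vs) (v, g))))"

text \<open>
  The library's \<^const>\<open>KL_divergence\<close> takes the reference measure first and is real-valued, with a
  junk value where the divergence is infinite: if \<open>Q\<close> is not absolutely continuous with respect to
  \<open>R\<close>, or if \<open>log (dQ / dR)\<close> is not \<open>Q\<close>-integrable (its negative part always is).
\<close>

definition KL :: "'a measure \<Rightarrow> 'a measure \<Rightarrow> ereal" where
  "KL Q R =
     (if absolutely_continuous R Q \<and> integrable Q (entropy_density (exp 1) R Q)
      then ereal (KL_divergence (exp 1) R Q) else \<infinity>)"

end

theory Submission
  imports Defs
begin

text \<open>
  The fixed prior conditional makes the finite-dimensional densities of a joint law explicit: on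
  the inputs \<open>js\<close> the law built from \<open>q\<close> over \<open>vs\<close> has density
  \<open>q(x, w) p(w\<^bsub>js\<^esub>) / p(w\<^bsub>vs\<^esub>)\<close>, where \<open>p\<close> is the prior density. Hence the law built from
  \<open>q(x, u)\<close> has density \<open>q(x, u) p(u\<^bsub>l\<^esub>) / (q'(x, u\<^bsub>l\<^esub>) p(u))\<close> with respect to the law built from
  \<open>q'(x, u\<^bsub>l\<^esub>)\<close>, and the divergence is a finite constant minus the expectation of \<open>ln q'\<close> under
  \<open>q\<close>. By Gibbs' inequality this is least exactly when \<open>q'\<close> is the marginal density of \<open>q\<close>, which
  is again Gaussian by the Schur complement factorisation of Gaussian densities.
\<close>

section \<open>Gaussian densities\<close>

text \<open>\<open>gp_conditional\<close> is a \<open>THE\<close>, so a process law on an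
  uncountable product must be exhibited for every \<open>v\<close>, and \<open>joint_law\<close>
  needs it to depend measurably on \<open>v\<close>. Both come from \<open>prior\<close>:
  conditional samples are affine corrections of prior samples, so Kolmogorov extension is avoided
  and the dependence on \<open>v\<close> is explicit. Semidefinite together with invertible is
  traded for \<open>pd_on\<close>, which passes to sublists and to Schur complements. Hence
  conditional covariances stay nondegenerate and all Gaussian densities are strictly positive, which
  legitimates the quotients. The constant is finite because the logarithm of a Gaussian density is a
  quadratic polynomial and the law built from \<open>q\<close> has second moments at the inducing
  points and in the state; the infinite branch of \<open>KL\<close> never occurs. Uniqueness is
  claimed for functions, not for classes modulo null sets. Equality in Gibbs' inequality only yields
  agreement almost everywhere; continuity of Gaussian densities in each coordinate closes the
  gap.\<close>

definition pd_on :: "('i \<Rightarrow> 'i \<Rightarrow> real) \<Rightarrow> 'i list \<Rightarrow> bool" where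
  "pd_on S js \<longleftrightarrow> (\<forall>i\<in>set js. \<forall>j\<in>set js. S i j = S j i) \<and>
     (\<forall>c\<in>carrier_vec (length js). c \<noteq> 0\<^sub>v (length js) \<longrightarrow> 0 < c \<bullet> (cov_mat S js js *\<^sub>v c))"

lemma cov_mat_carrier [simp]: "cov_mat S is js \<in> carrier_mat (length is) (length js)"
  by (simp add: cov_mat_def)

lemma dim_cov_mat [simp]: "dim_row (cov_mat S is js) = length is" "dim_col (cov_mat S is js) = length js"
  by (simp_all add: cov_mat_def)

lemma index_cov_mat [simp]:
  "a < length is \<Longrightarrow> b < length js \<Longrightarrow> cov_mat S is js $$ (a, b) = S (is ! a) (js ! b)"
  by (simp add: cov_mat_def)

lemma val_vec_carrier [simp]: "val_vec z js \<in> carrier_vec (length js)"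
  by (simp add: val_vec_def)

lemma dim_val_vec [simp]: "dim_vec (val_vec z js) = length js"
  by (simp add: val_vec_def)

lemma index_val_vec [simp]: "a < length js \<Longrightarrow> vec_index (val_vec z js) a = z (js ! a)"
  by (simp add: val_vec_def)

lemma inv_mat_eqI:
  assumes A: "A \<in> carrier_mat n n" and B: "B \<in> carrier_mat n n" and AB: "A * B = 1\<^sub>m n"
  shows "inv_mat A = B"
proof -
  have BA: "B * A = 1\<^sub>m n"
    using mat_mult_left_right_inverse[OF A B AB] .
  show ?thesis
    unfolding inv_mat_def
  proof (rule the_equality)
    show "inverts_mat A B \<and> inverts_mat B A"
      using A B AB BA by (auto simp: inverts_mat_def)
  next
    fix C assume C: "inverts_mat A C \<and> inverts_mat C A"
    then have AC: "A * C = 1\<^sub>m n" and CA: "C * A = 1\<^sub>m (dim_row C)"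
      using A by (auto simp: inverts_mat_def)
    \<comment> \<open>\<open>inverts_mat\<close> prescribes no dimensions for \<open>C\<close>; they
      are read off from the column counts of the two products.\<close>
    have "C \<in> carrier_mat n n"
      using arg_cong[OF AC, of dim_col] arg_cong[OF CA, of dim_col] A by auto
    then have "C = (B * A) * C" using BA by simp
    also have "\<dots> = B * (A * C)" by (rule assoc_mult_mat[OF B A \<open>C \<in> carrier_mat n n\<close>])
    also have "\<dots> = B" using AC B by simp
    finally show "C = B" .
  qed
qed

section \<open>Definiteness and inverses of covariance matrices\<close>

lemma pd_on_det_nonzero:
  assumes "pd_on S js"
  shows "Determinant.det (cov_mat S js js) \<noteq> 0"
proof
  assume "Determinant.det (cov_mat S js js) = 0"
  then obtain v where v: "v \<in> carrier_vec (length js)" "v \<noteq> 0\<^sub>v (length js)"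
      "cov_mat S js js *\<^sub>v v = 0\<^sub>v (length js)"
    using det_0_iff_vec_prod_zero[of "cov_mat S js js" "length js"] by auto
  then have "0 < v \<bullet> (0\<^sub>v (length js))"
    using assms unfolding pd_on_def by metis
  then show False using v by simp
qed

lemma invertible_matE:
  assumes "invertible_mat A" "A \<in> carrier_mat n n"
  obtains B where "B \<in> carrier_mat n n" "A * B = 1\<^sub>m n" "B * A = 1\<^sub>m n"
proof -
  from assms obtain B where "inverts_mat A B" "inverts_mat B A"
    unfolding invertible_mat_def by blast
  then have AB: "A * B = 1\<^sub>m n" and BA: "B * A = 1\<^sub>m (dim_row B)"
    using assms by (auto simp: inverts_mat_def)
  have "B \<in> carrier_mat n n"
    using arg_cong[OF AB, of dim_col] arg_cong[OF BA, of dim_col] assms(2) by auto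
  then show ?thesis using AB BA that by auto
qed

lemma
  assumes "pd_on S js"
  shows inv_cov_carrier: "inv_mat (cov_mat S js js) \<in> carrier_mat (length js) (length js)"
    and inv_cov_right: "cov_mat S js js * inv_mat (cov_mat S js js) = 1\<^sub>m (length js)"
    and inv_cov_left: "inv_mat (cov_mat S js js) * cov_mat S js js = 1\<^sub>m (length js)"
    and invertible_cov: "invertible_mat (cov_mat S js js)"
proof -
  let ?A = "cov_mat S js js" let ?n = "length js"
  have A: "?A \<in> carrier_mat ?n ?n" by simp
  obtain B where B: "B \<in> carrier_mat ?n ?n" "B * ?A = 1\<^sub>m ?n"
    using det_non_zero_imp_unit[OF A pd_on_det_nonzero[OF assms], of ?n]
    unfolding Units_def ring_mat_def by auto
  then have AB: "?A * B = 1\<^sub>m ?n" 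
    using mat_mult_left_right_inverse[OF B(1) A] by simp
  then have "inv_mat ?A = B" using inv_mat_eqI[OF A B(1)] by simp
  then show "inv_mat ?A \<in> carrier_mat ?n ?n" "?A * inv_mat ?A = 1\<^sub>m ?n" "inv_mat ?A * ?A = 1\<^sub>m ?n"
    using B AB by auto
  then show "invertible_mat ?A"
    unfolding invertible_mat_def by (auto simp: inverts_mat_def)
qed

lemma transpose_cov_mat: "transpose_mat (cov_mat S is js) = cov_mat (\<lambda>s t. S t s) js is"
  by (intro eq_matI) auto

lemma cov_mat_cong:
  "(\<And>i j. i \<in> set is \<Longrightarrow> j \<in> set js \<Longrightarrow> S i j = S' i j) \<Longrightarrow> cov_mat S is js = cov_mat S' is js"
  by (intro eq_matI) auto

text \<open>The linear coefficient is the derivative of the form at \<open>c\<close> in the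
  direction \<open>e\<close>, the quantity that \<open>pd_onI\<close> forces to vanish.\<close>

lemma quadratic_form_add_smult:
  fixes A :: "real mat"
  assumes A: "A \<in> carrier_mat n n" "transpose_mat A = A" and c: "c \<in> carrier_vec n" and e: "e \<in> carrier_vec n"
  shows "(c + t \<cdot>\<^sub>v e) \<bullet> (A *\<^sub>v (c + t \<cdot>\<^sub>v e)) =
    c \<bullet> (A *\<^sub>v c) + 2 * t * (e \<bullet> (A *\<^sub>v c)) + t\<^sup>2 * (e \<bullet> (A *\<^sub>v e))"
proof -
  have sym: "c \<bullet> (A *\<^sub>v e) = e \<bullet> (A *\<^sub>v c)"
    using transpose_vec_mult_scalar[OF A(1) e c] A c e
    by (metis comm_scalar_prod mult_mat_vec_carrier)
  have "A *\<^sub>v (c + t \<cdot>\<^sub>v e) = A *\<^sub>v c + t \<cdot>\<^sub>v (A *\<^sub>v e)"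
    using A c e by (simp add: mult_add_distrib_mat_vec mult_mat_vec)
  moreover have Ac: "A *\<^sub>v c \<in> carrier_vec n" and Ae: "A *\<^sub>v e \<in> carrier_vec n" using A c e by auto
  ultimately have "(c + t \<cdot>\<^sub>v e) \<bullet> (A *\<^sub>v (c + t \<cdot>\<^sub>v e)) = 
      (c \<bullet> (A *\<^sub>v c) + t * (c \<bullet> (A *\<^sub>v e))) + t * (e \<bullet> (A *\<^sub>v c) + t * (e \<bullet> (A *\<^sub>v e)))"
    using c e by (simp add: add_scalar_prod_distrib[of _ n] scalar_prod_add_distrib[of _ n] algebra_simps)
  then show ?thesis unfolding sym by (simp add: algebra_simps power2_eq_square)
qed

text \<open>A quadratic that is zero at 0 and nowhere negative has a minimum there, so its
  derivative at 0 is zero.\<close>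

lemma nonneg_quadratic_linear_term_zero:
  fixes a b :: real
  assumes "\<And>t. 0 \<le> 2 * t * a + t\<^sup>2 * b"
  shows "a = 0"
proof (rule ccontr)
  assume "a \<noteq> 0"
  \<comment> \<open>Any positive \<open>k\<close> with \<open>b < 2 * k\<close> would do: at
    \<open>t = - a / k\<close> the polynomial takes the value
    \<open>t\<^sup>2 * (b - 2 * k)\<close>.\<close>
  define k where "k = \<bar>b\<bar> + 1"
  define t where "t = - a / k"
  have k: "k > 0" "b < k" unfolding k_def by auto
  have ta: "a = - t * k" unfolding t_def using k by simp
  then have "t \<noteq> 0" using \<open>a \<noteq> 0\<close> by auto
  have "0 \<le> 2 * t * a + t\<^sup>2 * b" by (rule assms)
  also have "\<dots> = t\<^sup>2 * (b - 2 * k)"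
    unfolding ta by (simp add: power2_eq_square algebra_simps)
  also have "\<dots> < 0"
    using \<open>t \<noteq> 0\<close> k by (intro mult_pos_neg) simp_all
  finally show False by simp
qed

text \<open>If the form of a semidefinite \<open>A\<close> vanishes at \<open>c\<close>, then
  \<open>c\<close> is a minimiser, so the derivative in the direction \<open>A c\<close>, twice the
  squared norm of \<open>A c\<close>, is zero. Thus \<open>A c = 0\<close>, and invertibility gives
  \<open>c = 0\<close>.\<close>

lemma pd_onI:
  assumes "sym_psd (cov_mat S js js)" "invertible_mat (cov_mat S js js)"
  shows "pd_on S js"
proof -
  let ?A = "cov_mat S js js" let ?n = "length js"
  have A: "?A \<in> carrier_mat ?n ?n" by simp
  have sym: "transpose_mat ?A = ?A" and psd: "\<And>c. c \<in> carrier_vec ?n \<Longrightarrow> 0 \<le> c \<bullet> (?A *\<^sub>v c)"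
    using assms(1) by (auto simp: sym_psd_def)
  obtain B where B: "B \<in> carrier_mat ?n ?n" "B * ?A = 1\<^sub>m ?n"
    using invertible_matE[OF assms(2) A] by metis
  have "S i j = S j i" if ij: "i \<in> set js" "j \<in> set js" for i j
  proof -
    obtain a b where ab: "a < ?n" "b < ?n" "js ! a = i" "js ! b = j"
      using ij unfolding in_set_conv_nth by blast
    have "transpose_mat ?A $$ (a, b) = S j i" "?A $$ (a, b) = S i j"
      using ab by simp_all
    then show ?thesis unfolding sym by (rule trans[OF HOL.sym, rotated])
  qed
  moreover have "0 < c \<bullet> (?A *\<^sub>v c)" if c: "c \<in> carrier_vec ?n" "c \<noteq> 0\<^sub>v ?n" for c
  proof (rule ccontr)
    assume "\<not> ?thesis"
    then have 0: "c \<bullet> (?A *\<^sub>v c) = 0" using psd[OF c(1)] by simp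
    let ?e = "?A *\<^sub>v c"
    have e: "?e \<in> carrier_vec ?n" by (rule mult_mat_vec_carrier[OF A c(1)])
    have "?e \<bullet> ?e = 0"
    proof (rule nonneg_quadratic_linear_term_zero)
      fix t :: real
      have "0 \<le> (c + t \<cdot>\<^sub>v ?e) \<bullet> (?A *\<^sub>v (c + t \<cdot>\<^sub>v ?e))"
        using c e by (intro psd) auto
      then show "0 \<le> 2 * t * (?e \<bullet> ?e) + t\<^sup>2 * (?e \<bullet> (?A *\<^sub>v ?e))"
        unfolding quadratic_form_add_smult[OF A sym c(1) e] 0 by simp
    qed
    then have "?e = 0\<^sub>v ?n"
      using conjugate_square_eq_0_vec[of ?e ?n] e by (simp add: scalar_prod_def conjugate_vec_def)
    then have "B *\<^sub>v ?e = 0\<^sub>v ?n" using B by auto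
    moreover have "B *\<^sub>v ?e = c"
      using assoc_mult_mat_vec[OF B(1) A c(1)] B c by simp
    ultimately show False using c by simp
  qed
  ultimately show ?thesis by (auto simp: pd_on_def)
qed

lemma pd_on_sym_psd:
  assumes "pd_on S js"
  shows "sym_psd (cov_mat S js js)"
proof -
  have "0 \<le> c \<bullet> (cov_mat S js js *\<^sub>v c)" if "c \<in> carrier_vec (length js)" for c
    using assms that unfolding pd_on_def
    by (cases "c = 0\<^sub>v (length js)") (auto intro: less_imp_le simp: scalar_prod_left_zero[OF mult_mat_vec_carrier[OF cov_mat_carrier]])
  moreover have "transpose_mat (cov_mat S js js) = cov_mat S js js"
    unfolding transpose_cov_mat using assms by (intro cov_mat_cong) (auto simp: pd_on_def)
  ultimately show ?thesis by (simp add: sym_psd_def)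
qed

section \<open>Block decomposition and Schur complements\<close>

lemma cov_mat_append:
  "cov_mat S (as @ bs) (as @ bs) =
     four_block_mat (cov_mat S as as) (cov_mat S as bs) (cov_mat S bs as) (cov_mat S bs bs)"
  by (intro eq_matI) (auto simp: nth_append)

lemma val_vec_append: "val_vec z (as @ bs) = val_vec z as @\<^sub>v val_vec z bs"
  by (intro eq_vecI) (auto simp: nth_append)

lemma cov_mat_append_mult:
  assumes "u \<in> carrier_vec (length as)" "w \<in> carrier_vec (length bs)"
  shows "cov_mat S (as @ bs) (as @ bs) *\<^sub>v (u @\<^sub>v w) =
    (cov_mat S as as *\<^sub>v u + cov_mat S as bs *\<^sub>v w) @\<^sub>v (cov_mat S bs as *\<^sub>v u + cov_mat S bs bs *\<^sub>v w)"
  unfolding cov_mat_append using assms by (intro four_block_mat_mult_vec) auto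

lemma mult_mat_zero_vec:
  "A \<in> carrier_mat n m \<Longrightarrow> A *\<^sub>v 0\<^sub>v m = (0\<^sub>v n :: 'a :: semiring_0 Matrix.vec)"
  by (intro eq_vecI) (auto simp: scalar_prod_def)

lemma pd_on_appendD1:
  assumes "pd_on S (as @ bs)"
  shows "pd_on S as"
  unfolding pd_on_def
proof (intro conjI ballI impI)
  fix c :: "real Matrix.vec" assume c: "c \<in> carrier_vec (length as)" "c \<noteq> 0\<^sub>v (length as)"
  let ?z = "0\<^sub>v (length bs)"
  have "c @\<^sub>v ?z \<in> carrier_vec (length (as @ bs))" using c by auto
  moreover have "c @\<^sub>v ?z \<noteq> 0\<^sub>v (length (as @ bs))"
  proof
    assume eq: "c @\<^sub>v ?z = 0\<^sub>v (length (as @ bs))"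
    have "c = 0\<^sub>v (length as)"
    proof (rule eq_vecI)
      fix i assume i: "i < dim_vec (0\<^sub>v (length as))"
      show "vec_index c i = vec_index (0\<^sub>v (length as)) i"
        using arg_cong[OF eq, of "\<lambda>v. vec_index v i"] i c by simp
    qed (use c in auto)
    with c show False by simp
  qed
  ultimately have "0 < (c @\<^sub>v ?z) \<bullet> (cov_mat S (as @ bs) (as @ bs) *\<^sub>v (c @\<^sub>v ?z))"
    using assms unfolding pd_on_def by blast
  also have "cov_mat S (as @ bs) (as @ bs) *\<^sub>v (c @\<^sub>v ?z) =
      (cov_mat S as as *\<^sub>v c) @\<^sub>v (cov_mat S bs as *\<^sub>v c)"
    using right_zero_vec[OF mult_mat_vec_carrier[OF cov_mat_carrier c(1)]]
    by (simp add: cov_mat_append_mult[OF c(1)] mult_mat_zero_vec[OF cov_mat_carrier])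
  also have "(c @\<^sub>v ?z) \<bullet> \<dots> = c \<bullet> (cov_mat S as as *\<^sub>v c)"
    by (subst scalar_prod_append[OF c(1) zero_carrier_vec])
      (use mult_mat_vec_carrier[OF cov_mat_carrier c(1)] in simp_all)
  finally show "0 < c \<bullet> (cov_mat S as as *\<^sub>v c)" .
qed (use assms in \<open>auto simp: pd_on_def\<close>)

text \<open>Block elimination: the first block of the argument is chosen so that the first block of
  the product is \<open>r\<close>. With \<open>r = 0\<close> it gives definiteness of the Schur
  complement; with \<open>r\<close> the first data block it solves the full linear system, so the
  blockwise inverse is never written down.\<close>

lemma schur_mult_vec:
  fixes A B C D :: "real mat"
  assumes A: "A \<in> carrier_mat n n" and B: "B \<in> carrier_mat n m" and C: "C \<in> carrier_mat m n"
    and D: "D \<in> carrier_mat m m" and Ai: "Ai \<in> carrier_mat n n" "A * Ai = 1\<^sub>m n"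
    and r: "r \<in> carrier_vec n" and w: "w \<in> carrier_vec m"
  shows "four_block_mat A B C D *\<^sub>v ((Ai *\<^sub>v (r - B *\<^sub>v w)) @\<^sub>v w) =
    r @\<^sub>v (C *\<^sub>v (Ai *\<^sub>v r) + (D - C * Ai * B) *\<^sub>v w)"
proof -
  let ?u = "Ai *\<^sub>v (r - B *\<^sub>v w)"
  have Bw: "B *\<^sub>v w \<in> carrier_vec n" using B w by (rule mult_mat_vec_carrier)
  have rBw: "r - B *\<^sub>v w \<in> carrier_vec n" using r Bw by simp
  have u: "?u \<in> carrier_vec n" using Ai(1) rBw by (rule mult_mat_vec_carrier)
  have "A *\<^sub>v ?u = r - B *\<^sub>v w"
    using assoc_mult_mat_vec[OF A Ai(1) rBw] Ai(2) rBw by simp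
  then have 1: "A *\<^sub>v ?u + B *\<^sub>v w = r" using r B by (intro eq_vecI) auto
  have "C *\<^sub>v ?u = C *\<^sub>v (Ai *\<^sub>v r) - C *\<^sub>v (Ai *\<^sub>v (B *\<^sub>v w))"
    using mult_minus_distrib_mat_vec[OF Ai(1) r Bw] mult_minus_distrib_mat_vec[OF C] 
    by (metis Ai(1) Bw mult_mat_vec_carrier r)
  also have "C *\<^sub>v (Ai *\<^sub>v (B *\<^sub>v w)) = (C * Ai * B) *\<^sub>v w"
    using assoc_mult_mat_vec[OF C Ai(1) Bw] assoc_mult_mat_vec[of "C * Ai" m n B m w] B C Ai(1) w by simp
  finally have "C *\<^sub>v ?u + D *\<^sub>v w = C *\<^sub>v (Ai *\<^sub>v r) + (D - C * Ai * B) *\<^sub>v w"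
    using minus_mult_distrib_mat_vec[of D m m "C * Ai * B" w] D C Ai B w r by (intro eq_vecI) auto
  with 1 show ?thesis
    using four_block_mat_mult_vec[OF A B C D u w] by simp
qed

text \<open>Block LU factorisation: the lower factor has identity blocks on its diagonal, hence
  determinant one, and the upper factor carries \<open>A\<close> and the Schur complement.\<close>

lemma det_schur:
  fixes A B C D :: "real mat"
  assumes A: "A \<in> carrier_mat n n" and B: "B \<in> carrier_mat n m" and C: "C \<in> carrier_mat m n"
    and D: "D \<in> carrier_mat m m" and Ai: "Ai \<in> carrier_mat n n" "Ai * A = 1\<^sub>m n"
  shows "Determinant.det (four_block_mat A B C D) =
    Determinant.det A * Determinant.det (D - C * Ai * B)"
proof -
  let ?S = "D - C * Ai * B"
  have S: "?S \<in> carrier_mat m m" using C Ai(1) B D by auto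
  have CAi: "C * Ai \<in> carrier_mat m n" using C Ai by simp
  have "C * Ai * A = C" using assoc_mult_mat[OF C Ai(1) A] Ai(2) C by simp
  moreover have "C * Ai * B + ?S = D" using C Ai(1) B D by (intro eq_matI) auto
  ultimately have "four_block_mat (1\<^sub>m n) (0\<^sub>m n m) (C * Ai) (1\<^sub>m m) * four_block_mat A B (0\<^sub>m m n) ?S =
      four_block_mat A B C D"
    using mult_four_block_mat[OF one_carrier_mat zero_carrier_mat CAi one_carrier_mat A B zero_carrier_mat S]
      A B C D S CAi by simp
  then have "Determinant.det (four_block_mat A B C D) =
      Determinant.det (four_block_mat (1\<^sub>m n) (0\<^sub>m n m) (C * Ai) (1\<^sub>m m)) *
      Determinant.det (four_block_mat A B (0\<^sub>m m n) ?S)"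
    using Determinant.det_mult[OF four_block_carrier_mat[OF one_carrier_mat one_carrier_mat]
      four_block_carrier_mat[OF A S]] by metis
  then show ?thesis
    using det_four_block_mat_lower_left_zero[OF A B refl S]
      det_four_block_mat_upper_right_zero[OF one_carrier_mat refl CAi one_carrier_mat] by simp
qed

lemma cov_mat_cond_cov:
  assumes "inv_mat (cov_mat S vs vs) \<in> carrier_mat (length vs) (length vs)"
  shows "cov_mat (cond_cov S vs) is js =
    cov_mat S is js - cov_mat S is vs * inv_mat (cov_mat S vs vs) * cov_mat S vs js"
  using assms by (intro eq_matI) (auto simp: cond_cov_def scalar_prod_def)

lemma val_vec_cond_mean:
  assumes "inv_mat (cov_mat S vs vs) \<in> carrier_mat (length vs) (length vs)"
  shows "val_vec (cond_mean S vs z) is = cov_mat S is vs *\<^sub>v (inv_mat (cov_mat S vs vs) *\<^sub>v val_vec z vs)"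
proof -
  have "val_vec (cond_mean S vs z) is = (cov_mat S is vs * inv_mat (cov_mat S vs vs)) *\<^sub>v val_vec z vs"
    using assms by (intro eq_vecI) (auto simp: cond_mean_def scalar_prod_def)
  then show ?thesis
    using assoc_mult_mat_vec[OF cov_mat_carrier assms val_vec_carrier] by simp
qed

lemma pd_on_transpose:
  assumes "pd_on S (as @ bs)"
  shows "transpose_mat (cov_mat S as bs) = cov_mat S bs as"
  unfolding transpose_cov_mat using assms by (intro cov_mat_cong) (auto simp: pd_on_def)

lemma transpose_inv_cov:
  assumes "pd_on S js"
  shows "transpose_mat (inv_mat (cov_mat S js js)) = inv_mat (cov_mat S js js)"
proof -
  let ?A = "cov_mat S js js" let ?n = "length js"
  have "transpose_mat ?A = ?A"
    unfolding transpose_cov_mat using assms by (intro cov_mat_cong) (auto simp: pd_on_def)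
  then have "?A * transpose_mat (inv_mat ?A) = transpose_mat (inv_mat ?A * ?A)"
    using transpose_mult[OF inv_cov_carrier[OF assms] cov_mat_carrier] by simp
  also have "\<dots> = 1\<^sub>m ?n" using inv_cov_left[OF assms] by simp
  finally show ?thesis
    using inv_mat_eqI[OF cov_mat_carrier, of "transpose_mat (inv_mat ?A)" js S] inv_cov_carrier[OF assms]
    by simp
qed

text \<open>The form of the Schur complement at \<open>c\<close> is the full form at the vector with
  second block \<open>c\<close> and first block \<open>- A^-1 B c\<close>, the minimiser over all
  first blocks. That vector is nonzero because \<open>c\<close> is.\<close>

lemma pd_on_cond_cov:
  assumes pd: "pd_on S (as @ bs)"
  shows "pd_on (cond_cov S as) bs"
proof -
  let ?A = "cov_mat S as as" and ?B = "cov_mat S as bs" and ?C = "cov_mat S bs as" and ?D = "cov_mat S bs bs"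
  let ?n = "length as" and ?m = "length bs"
  let ?Ai = "inv_mat ?A"
  have pdA: "pd_on S as" using pd by (rule pd_on_appendD1)
  note Ai = inv_cov_carrier[OF pdA] inv_cov_right[OF pdA]
  have S: "cov_mat (cond_cov S as) bs bs = ?D - ?C * ?Ai * ?B"
    using cov_mat_cond_cov[OF Ai(1)] .
  have "transpose_mat (?C * ?Ai * ?B) = ?C * ?Ai * ?B"
  proof -
    have "transpose_mat (?C * ?Ai * ?B) = transpose_mat ?B * (transpose_mat ?Ai * transpose_mat ?C)"
      using transpose_mult[OF mult_carrier_mat[OF cov_mat_carrier Ai(1)] cov_mat_carrier, of S bs S bs]
        transpose_mult[OF cov_mat_carrier Ai(1), of S bs] by simp
    also have "transpose_mat ?B = ?C" using pd by (rule pd_on_transpose)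
    also have "transpose_mat ?C = ?B" using \<open>transpose_mat ?B = ?C\<close> transpose_transpose by metis
    also have "transpose_mat ?Ai = ?Ai" using pdA by (rule transpose_inv_cov)
    finally show ?thesis using assoc_mult_mat[OF cov_mat_carrier Ai(1) cov_mat_carrier, of S bs S bs] by simp
  qed
  moreover have "transpose_mat ?D = ?D"
    unfolding transpose_cov_mat using pd by (intro cov_mat_cong) (auto simp: pd_on_def)
  ultimately have T: "transpose_mat (?D - ?C * ?Ai * ?B) = ?D - ?C * ?Ai * ?B"
    using transpose_minus[of ?D ?m ?m "?C * ?Ai * ?B"]
      mult_carrier_mat[OF mult_carrier_mat[OF cov_mat_carrier Ai(1)] cov_mat_carrier, of S bs S bs] by simp
  have "cond_cov S as i j = cond_cov S as j i" if ij: "i \<in> set bs" "j \<in> set bs" for i j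
  proof -
    obtain a b where ab: "a < ?m" "b < ?m" "bs ! a = i" "bs ! b = j"
      using ij unfolding in_set_conv_nth by blast
    have "transpose_mat (cov_mat (cond_cov S as) bs bs) $$ (a, b) = cond_cov S as j i"
      "cov_mat (cond_cov S as) bs bs $$ (a, b) = cond_cov S as i j"
      using ab by simp_all
    then show ?thesis using T S by simp
  qed
  moreover have "0 < c \<bullet> (cov_mat (cond_cov S as) bs bs *\<^sub>v c)"
    if c: "c \<in> carrier_vec ?m" "c \<noteq> 0\<^sub>v ?m" for c
  proof -
    let ?S = "?D - ?C * ?Ai * ?B"
    have Sc: "?S *\<^sub>v c \<in> carrier_vec ?m"
      by (rule mult_mat_vec_carrier[OF minus_carrier_mat[OF mult_carrier_mat[OF
        mult_carrier_mat[OF cov_mat_carrier Ai(1)] cov_mat_carrier]] c(1)])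
    let ?u = "?Ai *\<^sub>v (0\<^sub>v ?n - ?B *\<^sub>v c)"
    have u: "?u \<in> carrier_vec ?n"
      by (rule mult_mat_vec_carrier[OF Ai(1)]) (use mult_mat_vec_carrier[OF cov_mat_carrier c(1)] in simp)
    have "?u @\<^sub>v c \<noteq> 0\<^sub>v (?n + ?m)"
    proof
      assume eq: "?u @\<^sub>v c = 0\<^sub>v (?n + ?m)"
      have "0\<^sub>v (?n + ?m) = (0\<^sub>v ?n @\<^sub>v 0\<^sub>v ?m :: real Matrix.vec)" by (intro eq_vecI) auto
      then have "c = 0\<^sub>v ?m"
        using eq append_vec_eq[OF u zero_carrier_vec] by simp
      with c show False by simp
    qed
    moreover have "?u @\<^sub>v c \<in> carrier_vec (length (as @ bs))" using u c(1) by simp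
    ultimately have "0 < (?u @\<^sub>v c) \<bullet> (cov_mat S (as @ bs) (as @ bs) *\<^sub>v (?u @\<^sub>v c))"
      using pd unfolding pd_on_def length_append by blast
    also have "cov_mat S (as @ bs) (as @ bs) *\<^sub>v (?u @\<^sub>v c) =
        0\<^sub>v ?n @\<^sub>v (?C *\<^sub>v (?Ai *\<^sub>v 0\<^sub>v ?n) + ?S *\<^sub>v c)"
      unfolding cov_mat_append by (rule schur_mult_vec[OF _ _ _ _ Ai]) (use c in simp_all)
    also have "?Ai *\<^sub>v 0\<^sub>v ?n = 0\<^sub>v ?n" by (rule mult_mat_zero_vec[OF Ai(1)])
    also have "?C *\<^sub>v 0\<^sub>v ?n = 0\<^sub>v ?m" by (rule mult_mat_zero_vec[OF cov_mat_carrier])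
    also have "0\<^sub>v ?m + ?S *\<^sub>v c = ?S *\<^sub>v c"
      by (rule left_zero_vec[OF Sc])
    also have "(?u @\<^sub>v c) \<bullet> (0\<^sub>v ?n @\<^sub>v (?S *\<^sub>v c)) = ?u \<bullet> 0\<^sub>v ?n + c \<bullet> (?S *\<^sub>v c)"
      by (rule scalar_prod_append[OF u c(1) zero_carrier_vec Sc])
    finally show ?thesis using u S by simp
  qed
  ultimately show ?thesis unfolding pd_on_def by blast
qed

lemma inv_mat_mult_vec_eqI:
  assumes "pd_on S js" "x \<in> carrier_vec (length js)" "cov_mat S js js *\<^sub>v x = y"
  shows "inv_mat (cov_mat S js js) *\<^sub>v y = x"
  using assoc_mult_mat_vec[OF inv_cov_carrier[OF assms(1)] cov_mat_carrier assms(2), of S]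
    inv_cov_left[OF assms(1)] assms by simp

text \<open>Completing the square: \<open>e\<close> is the residual of the second block after
  prediction from the first.\<close>

lemma quadratic_form_append:
  fixes z :: "'i \<Rightarrow> real"
  assumes pd: "pd_on S (as @ bs)"
  defines "e \<equiv> val_vec z bs - val_vec (cond_mean S as z) bs"
  shows "val_vec z (as @ bs) \<bullet> (inv_mat (cov_mat S (as @ bs) (as @ bs)) *\<^sub>v val_vec z (as @ bs)) =
    val_vec z as \<bullet> (inv_mat (cov_mat S as as) *\<^sub>v val_vec z as) +
    e \<bullet> (inv_mat (cov_mat (cond_cov S as) bs bs) *\<^sub>v e)"
proof -
  let ?A = "cov_mat S as as" and ?B = "cov_mat S as bs" and ?C = "cov_mat S bs as" and ?D = "cov_mat S bs bs"
  let ?n = "length as" and ?m = "length bs"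
  let ?Ai = "inv_mat ?A"
  let ?y1 = "val_vec z as" and ?y2 = "val_vec z bs"
  have pdA: "pd_on S as" using pd by (rule pd_on_appendD1)
  note Ai = inv_cov_carrier[OF pdA] inv_cov_right[OF pdA]
  note pdS = pd_on_cond_cov[OF pd]
  let ?S = "cov_mat (cond_cov S as) bs bs"
  have S: "?S = ?D - ?C * ?Ai * ?B"
    using cov_mat_cond_cov[OF Ai(1)] .
  have mu: "val_vec (cond_mean S as z) bs = ?C *\<^sub>v (?Ai *\<^sub>v ?y1)"
    using val_vec_cond_mean[OF Ai(1)] .
  have e: "e \<in> carrier_vec ?m" by (simp add: e_def)
  \<comment> \<open>The full system is solved by back substitution: \<open>w\<close> from the Schur
    complement and the residual, then \<open>u\<close> from the first block row. Together they are
    the full inverse applied to the data.\<close>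
  define w where "w = inv_mat ?S *\<^sub>v e"
  have w: "w \<in> carrier_vec ?m" unfolding w_def by (rule mult_mat_vec_carrier[OF inv_cov_carrier[OF pdS] e])
  have Sw: "?S *\<^sub>v w = e"
    unfolding w_def using assoc_mult_mat_vec[OF cov_mat_carrier inv_cov_carrier[OF pdS] e, symmetric]
      inv_cov_right[OF pdS] e by simp
  have Bw: "?B *\<^sub>v w \<in> carrier_vec ?n" by (rule mult_mat_vec_carrier[OF cov_mat_carrier w])
  define u where "u = ?Ai *\<^sub>v (?y1 - ?B *\<^sub>v w)"
  have u: "u \<in> carrier_vec ?n" unfolding u_def by (rule mult_mat_vec_carrier[OF Ai(1)]) (use Bw in simp)
  have "cov_mat S (as @ bs) (as @ bs) *\<^sub>v (u @\<^sub>v w) = ?y1 @\<^sub>v (?C *\<^sub>v (?Ai *\<^sub>v ?y1) + ?S *\<^sub>v w)"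
    unfolding cov_mat_append u_def S by (rule schur_mult_vec[OF _ _ _ _ Ai]) (use w in simp_all)
  also have "?C *\<^sub>v (?Ai *\<^sub>v ?y1) + ?S *\<^sub>v w = ?y2"
    unfolding Sw unfolding e_def mu[symmetric] by (intro eq_vecI) auto
  finally have "cov_mat S (as @ bs) (as @ bs) *\<^sub>v (u @\<^sub>v w) = val_vec z (as @ bs)"
    by (simp add: val_vec_append)
  moreover have "u @\<^sub>v w \<in> carrier_vec (length (as @ bs))" using u w by simp
  ultimately have "inv_mat (cov_mat S (as @ bs) (as @ bs)) *\<^sub>v val_vec z (as @ bs) = u @\<^sub>v w"
    by (intro inv_mat_mult_vec_eqI[OF pd])
  then have "val_vec z (as @ bs) \<bullet> (inv_mat (cov_mat S (as @ bs) (as @ bs)) *\<^sub>v val_vec z (as @ bs))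
      = ?y1 \<bullet> u + ?y2 \<bullet> w"
    unfolding val_vec_append using scalar_prod_append[OF val_vec_carrier val_vec_carrier u w] by simp
  also have "?y1 \<bullet> u = ?y1 \<bullet> (?Ai *\<^sub>v ?y1) - ?y1 \<bullet> (?Ai *\<^sub>v (?B *\<^sub>v w))"
    unfolding u_def using mult_minus_distrib_mat_vec[OF Ai(1) val_vec_carrier Bw]
      scalar_prod_minus_distrib[of ?y1 ?n] mult_mat_vec_carrier[OF Ai(1)] Bw by simp
  also have "?y1 \<bullet> (?Ai *\<^sub>v (?B *\<^sub>v w)) = (transpose_mat (?Ai * ?B) *\<^sub>v ?y1) \<bullet> w"
    using transpose_vec_mult_scalar[of "?Ai * ?B" ?n ?m w ?y1] w Ai(1)
      assoc_mult_mat_vec[OF Ai(1) cov_mat_carrier w] by simp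
  also have "transpose_mat (?Ai * ?B) = ?C * ?Ai"
    using transpose_mult[OF Ai(1) cov_mat_carrier, of S bs] transpose_inv_cov[OF pdA] pd_on_transpose[OF pd] by simp
  also have "?C * ?Ai *\<^sub>v ?y1 = val_vec (cond_mean S as z) bs"
    unfolding mu by (rule assoc_mult_mat_vec[OF cov_mat_carrier Ai(1) val_vec_carrier])
  finally show ?thesis
    unfolding w_def[symmetric] unfolding e_def
    using minus_scalar_prod_distrib[OF val_vec_carrier val_vec_carrier w] by simp
qed

lemma det_cov_mat_append:
  assumes "pd_on S (as @ bs)"
  shows "Determinant.det (cov_mat S (as @ bs) (as @ bs)) =
    Determinant.det (cov_mat S as as) * Determinant.det (cov_mat (cond_cov S as) bs bs)"
proof -
  have pdA: "pd_on S as" using assms by (rule pd_on_appendD1)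
  show ?thesis
    unfolding cov_mat_append cov_mat_cond_cov[OF inv_cov_carrier[OF pdA]]
    by (rule det_schur[OF _ _ _ _ inv_cov_carrier[OF pdA] inv_cov_left[OF pdA]]) (rule cov_mat_carrier)+
qed

section \<open>Positive determinants and the chain rule for Gaussian densities\<close>

lemma pd_on_singleton:
  "pd_on S [a] \<longleftrightarrow> 0 < S a a"
proof -
  have *: "c \<bullet> (cov_mat S [a] [a] *\<^sub>v c) = (vec_index c 0)\<^sup>2 * S a a" if "c \<in> carrier_vec 1" for c
    using that by (simp add: scalar_prod_def power2_eq_square)
  have **: "c \<noteq> 0\<^sub>v 1 \<longleftrightarrow> vec_index c 0 \<noteq> 0" if "c \<in> carrier_vec 1" for c :: "real Matrix.vec"
    using that by (auto simp: Matrix.vec_eq_iff)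
  have "0 < S a a" if "pd_on S [a]"
  proof -
    have "Matrix.vec 1 (\<lambda>_. 1) \<in> carrier_vec 1" "Matrix.vec 1 (\<lambda>_. 1 :: real) \<noteq> 0\<^sub>v 1"
      by (auto simp: Matrix.vec_eq_iff)
    then show ?thesis
      using that *[of "Matrix.vec 1 (\<lambda>_. 1)"] unfolding pd_on_def by fastforce
  qed
  then show ?thesis
    unfolding pd_on_def using * ** by (auto simp: zero_less_mult_iff)
qed

lemma det_cov_mat_singleton: "Determinant.det (cov_mat S [a] [a]) = S a a"
  using det_single[of "cov_mat S [a] [a]"] cov_mat_carrier[of S "[a]" "[a]"] by simp

text \<open>The determinant is the product of successive conditional variances. \<open>S\<close> is
  generalised because the induction step passes to \<open>cond_cov S [a]\<close>.\<close>

lemma det_cov_mat_pos: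
  assumes "pd_on S js"
  shows "0 < Determinant.det (cov_mat S js js)"
  using assms
proof (induction js arbitrary: S)
  case Nil
  then show ?case using det_dim_zero[of "cov_mat S [] []"] cov_mat_carrier[of S "[]" "[]"] by simp
next
  case (Cons a js)
  have pd: "pd_on S ([a] @ js)" using Cons.prems by simp
  have "0 < Determinant.det (cov_mat (cond_cov S [a]) js js)"
    by (rule Cons.IH[OF pd_on_cond_cov[OF pd]])
  moreover have "0 < Determinant.det (cov_mat S [a] [a])"
    using pd_on_appendD1[OF pd] by (simp add: det_cov_mat_singleton pd_on_singleton)
  ultimately show ?case
    using det_cov_mat_append[OF pd] by simp
qed

lemma gaussian_density_pos:
  assumes "pd_on S js"
  shows "0 < gaussian_density js m S z"
  using det_cov_mat_pos[OF assms] by (simp add: gaussian_density_def Let_def)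

lemma val_vec_diff: "val_vec z js - val_vec m js = val_vec (\<lambda>j. z j - m j) js"
  by (intro eq_vecI) auto

lemma val_vec_cong: "(\<And>j. j \<in> set js \<Longrightarrow> z j = z' j) \<Longrightarrow> val_vec z js = val_vec z' js"
  by (intro eq_vecI) auto

lemma gaussian_density_cong:
  assumes "\<And>j. j \<in> set js \<Longrightarrow> z j - m j = z' j - m' j"
  shows "gaussian_density js m S z = gaussian_density js m' S z'"
  unfolding gaussian_density_def val_vec_diff using val_vec_cong[OF assms, of js] by simp

text \<open>Chain rule, marginal times conditional: completing the square splits the exponent and
  the Schur determinant splits the normalisation. A general mean is reduced to this case by
  \<open>gaussian_density_shift\<close>.\<close>

lemma gaussian_density_append:
  assumes pd: "pd_on S (as @ bs)"
  shows "gaussian_density (as @ bs) (\<lambda>_. 0) S z =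
    gaussian_density as (\<lambda>_. 0) S z * gaussian_density bs (cond_mean S as z) (cond_cov S as) z"
proof -
  have [simp]: "val_vec z js - val_vec (\<lambda>_. 0) js = val_vec z js" for js
    by (simp add: val_vec_diff)
  have "exp (- (a + b) / 2) / sqrt ((2 * pi) ^ (n + k) * (d * d')) =
      (exp (- a / 2) / sqrt ((2 * pi) ^ n * d)) * (exp (- b / 2) / sqrt ((2 * pi) ^ k * d'))"
    for a b d d' :: real and n k
  proof -
    have "- (a + b) / 2 = - a / 2 + - b / 2" by simp
    then have "exp (- (a + b) / 2) = exp (- a / 2) * exp (- b / 2)" by (simp only: exp_add)
    then show ?thesis by (simp add: real_sqrt_mult power_add)
  qed
  then show ?thesis
    unfolding gaussian_density_def Let_def
    by (simp add: quadratic_form_append[OF pd] det_cov_mat_append[OF pd])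
qed

lemma gaussian_density_shift: "gaussian_density js m S z = gaussian_density js (\<lambda>_. 0) S (\<lambda>j. z j - m j)"
  by (intro gaussian_density_cong) simp

lemma inv_cov_singleton:
  assumes "0 < S a a"
  shows "inv_mat (cov_mat S [a] [a]) = Matrix.mat 1 1 (\<lambda>_. 1 / S a a)"
  using assms by (intro inv_mat_eqI[where n = 1] eq_matI) (auto simp: scalar_prod_def)

lemma gaussian_density_singleton:
  assumes "0 < S a a"
  shows "gaussian_density [a] m S z = normal_density (m a) (sqrt (S a a)) (z a)"
  using assms
  by (simp add: gaussian_density_def Let_def det_cov_mat_singleton inv_cov_singleton normal_density_def
      scalar_prod_def power2_eq_square)

section \<open>Coordinate sums and independence of the order of indices\<close>

lemma quadratic_form_sum:
  assumes "B \<in> carrier_mat (length js) (length js)"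
  shows "val_vec y js \<bullet> (B *\<^sub>v val_vec y js) =
    (\<Sum>a<length js. \<Sum>b<length js. B $$ (a, b) * (y (js ! a) * y (js ! b)))"
  using assms by (auto simp: scalar_prod_def sum_distrib_left atLeast0LessThan ac_simps intro!: sum.cong)

text \<open>In coordinates, measurability, continuity in one variable and the quadratic growth of
  the logarithm can be read off.\<close>

lemma gaussian_density_eq_sum:
  assumes "pd_on S js"
  shows "gaussian_density js m S z =
    exp (- (\<Sum>a<length js. \<Sum>b<length js. inv_mat (cov_mat S js js) $$ (a, b) *
        ((z (js ! a) - m (js ! a)) * (z (js ! b) - m (js ! b)))) / 2)
      / sqrt ((2 * pi) ^ length js * Determinant.det (cov_mat S js js))"
  by (simp add: gaussian_density_def Let_def val_vec_diff quadratic_form_sum[OF inv_cov_carrier[OF assms]])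

text \<open>Sums over \<open>set js\<close> forget the order of the list, so passing to another list
  of the same or fewer indices needs no matrix calculation.\<close>

lemma pd_on_iff_sum:
  assumes "distinct js"
  shows "pd_on S js \<longleftrightarrow> (\<forall>i\<in>set js. \<forall>j\<in>set js. S i j = S j i) \<and>
     (\<forall>c. (\<exists>j\<in>set js. c j \<noteq> 0) \<longrightarrow> 0 < (\<Sum>i\<in>set js. \<Sum>j\<in>set js. S i j * (c i * c j)))"
proof -
  let ?n = "length js"
  have bij: "bij_betw ((!) js) {..<?n} (set js)" by (rule bij_betw_nth[OF assms]) auto
  have sum: "(\<Sum>i\<in>set js. \<Sum>j\<in>set js. S i j * (c i * c j)) = val_vec c js \<bullet> (cov_mat S js js *\<^sub>v val_vec c js)" for c
    unfolding quadratic_form_sum[OF cov_mat_carrier] sum.reindex_bij_betw[OF bij, symmetric]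
    by simp
  have zero: "val_vec c js = 0\<^sub>v ?n \<longleftrightarrow> (\<forall>j\<in>set js. c j = 0)" for c
    by (simp add: Matrix.vec_eq_iff all_set_conv_all_nth)
  have "(\<forall>c\<in>carrier_vec ?n. P c) \<longleftrightarrow> (\<forall>c. P (val_vec c js))" for P
  proof (intro iffI allI ballI)
    fix c :: "real Matrix.vec" assume all: "\<forall>c. P (val_vec c js)" and c: "c \<in> carrier_vec ?n"
    have "val_vec (\<lambda>j. vec_index c (the_inv_into {..<?n} ((!) js) j)) js = c"
      using c bij by (intro eq_vecI) (auto simp: the_inv_into_f_f bij_betw_def)
    then show "P c" using all by metis
  qed auto
  then show ?thesis unfolding pd_on_def sum using zero by auto
qed

lemma pd_on_set_mono:
  assumes "pd_on S js" "distinct js" "distinct is" "set is \<subseteq> set js"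
  shows "pd_on S is"
  unfolding pd_on_iff_sum[OF assms(3)]
proof (intro conjI ballI allI impI)
  fix c :: "'a \<Rightarrow> real" assume "\<exists>j\<in>set is. c j \<noteq> 0"
  define c' where "c' j = (if j \<in> set is then c j else 0)" for j
  have "\<exists>j\<in>set js. c' j \<noteq> 0" using \<open>\<exists>j\<in>set is. c j \<noteq> 0\<close> assms(4) by (auto simp: c'_def)
  then have "0 < (\<Sum>i\<in>set js. \<Sum>j\<in>set js. S i j * (c' i * c' j))"
    using assms(1) unfolding pd_on_iff_sum[OF assms(2)] by blast
  also have "\<dots> = (\<Sum>i\<in>set js. \<Sum>j\<in>set is. S i j * (c' i * c' j))"
    using assms(4) by (intro sum.cong refl sum.mono_neutral_right) (auto simp: c'_def)
  also have "\<dots> = (\<Sum>i\<in>set is. \<Sum>j\<in>set is. S i j * (c' i * c' j))"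
    using assms(4) by (intro sum.mono_neutral_right) (auto simp: c'_def)
  finally show "0 < (\<Sum>i\<in>set is. \<Sum>j\<in>set is. S i j * (c i * c j))" by (simp add: c'_def)
qed (use assms in \<open>auto simp: pd_on_def\<close>)

text \<open>\<open>is_gaussian\<close> supplies its index list in unknown order, while elimination
  needs a chosen index first or last. A permutation acts on rows and columns at once: it carries the
  inverse along, and its sign enters the determinant twice.\<close>

lemma gaussian_density_permute:
  assumes pd: "pd_on S js" and "distinct js" "distinct is" "set is = set js"
  shows "gaussian_density is m S z = gaussian_density js m S z"
proof -
  let ?n = "length js"
  have "mset js = mset is"
    using assms(2-) by (metis set_eq_iff_mset_eq_distinct)
  then obtain p where p: "p permutes {..<?n}" "permute_list p js = is"
    by (metis mset_eq_permutation)
  have len: "length is = ?n" using p(2) by auto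
  have nth: "is ! a = js ! p a" if "a < ?n" for a
    using p that by (auto simp: permute_list_nth)
  have pn: "p a < ?n \<longleftrightarrow> a < ?n" for a using permutes_in_image[OF p(1), of a] by simp
  let ?A = "cov_mat S js js" and ?B = "inv_mat (cov_mat S js js)"
  have cov: "cov_mat S is is = Matrix.mat ?n ?n (\<lambda>(a, b). ?A $$ (p a, p b))"
    using len nth pn by (intro eq_matI) auto
  let ?B' = "Matrix.mat ?n ?n (\<lambda>(a, b). ?B $$ (p a, p b))"
  have B: "?B \<in> carrier_mat ?n ?n" by (rule inv_cov_carrier[OF pd])
  have "inv_mat (cov_mat S is is) = ?B'"
  proof (rule inv_mat_eqI)
    show "cov_mat S is is * ?B' = 1\<^sub>m ?n"
    proof (rule eq_matI)
      fix a b assume "a < dim_row (1\<^sub>m ?n)" "b < dim_col (1\<^sub>m ?n)"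
      then have ab: "a < ?n" "b < ?n" by auto
      have "(cov_mat S is is * ?B') $$ (a, b) = (\<Sum>k<?n. ?A $$ (p a, p k) * ?B $$ (p k, p b))"
        using ab unfolding cov by (simp add: scalar_prod_def atLeast0LessThan)
      also have "\<dots> = (\<Sum>k<?n. ?A $$ (p a, k) * ?B $$ (k, p b))"
        using sum.permute[OF p(1), of "\<lambda>k. ?A $$ (p a, k) * ?B $$ (k, p b)"] by (simp add: comp_def)
      also have "\<dots> = (?A * ?B) $$ (p a, p b)"
        using ab pn B by (simp add: scalar_prod_def atLeast0LessThan)
      also have "\<dots> = 1\<^sub>m ?n $$ (a, b)"
        unfolding inv_cov_right[OF pd] using ab pn permutes_inj[OF p(1)] by (auto dest: injD)
      finally show "(cov_mat S is is * ?B') $$ (a, b) = 1\<^sub>m ?n $$ (a, b)" .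
    qed (auto simp: len)
  qed (use cov_mat_carrier[of S "is" "is"] len in auto)
  then have "val_vec y is \<bullet> (inv_mat (cov_mat S is is) *\<^sub>v val_vec y is) =
      val_vec y js \<bullet> (?B *\<^sub>v val_vec y js)" for y
    using sum.permute[OF p(1), of "\<lambda>a. \<Sum>b<?n. ?B $$ (a, b) * (y (js ! a) * y (js ! b))"]
      sum.permute[OF p(1), of "\<lambda>b. ?B $$ (p a, b) * (y (js ! p a) * y (js ! b))" for a]
    by (simp add: quadratic_form_sum B len nth comp_def)
  moreover have "Determinant.det (cov_mat S is is) = Determinant.det ?A"
  proof -
    have p0: "p permutes {0..<?n}" using p(1) by (simp add: atLeast0LessThan)
    let ?M = "Matrix.mat ?n ?n (\<lambda>(a, b). ?A $$ (p a, b))"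
    \<comment> \<open>The simultaneous permutation is split into two row permutations, the second
      performed on the transpose.\<close>
    have "cov_mat S is is = transpose_mat (Matrix.mat ?n ?n (\<lambda>(a, b). transpose_mat ?M $$ (p a, b)))"
      unfolding cov using pn by (intro eq_matI) auto
    then have "Determinant.det (cov_mat S is is) = signof p * Determinant.det (transpose_mat ?M)"
      using det_transpose[of "Matrix.mat ?n ?n (\<lambda>(a, b). transpose_mat ?M $$ (p a, b))" ?n]
        det_permute_rows[of "transpose_mat ?M" ?n, OF _ p0] by simp
    also have "\<dots> = signof p * (signof p * Determinant.det ?A)"
      using det_transpose[of ?M ?n] det_permute_rows[of ?A ?n, OF _ p0] by simp
    finally show ?thesis by (simp add: sign_def)
  qed
  ultimately show ?thesis
    unfolding gaussian_density_def Let_def val_vec_diff len by simp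
qed

section \<open>Integration against Gaussian densities\<close>

lemma product_sigma_finite_lborel: "product_sigma_finite (\<lambda>_::'i. lborel :: real measure)"
  by standard

lemma borel_measurable_gaussian_density:
  assumes "pd_on S js" "\<And>j. j \<in> set js \<Longrightarrow> (\<lambda>\<omega>. X \<omega> j - m \<omega> j) \<in> borel_measurable M"
  shows "(\<lambda>\<omega>. gaussian_density js (m \<omega>) S (X \<omega>)) \<in> borel_measurable M"
proof -
  have [measurable]: "(\<lambda>\<omega>. X \<omega> (js ! a) - m \<omega> (js ! a)) \<in> borel_measurable M" if "a < length js" for a
    using assms(2) that by simp
  show ?thesis
    unfolding gaussian_density_eq_sum[OF assms(1)] by measurable
qed

lemma cond_mean_eq_sum:
  "cond_mean S vs z s =
    (\<Sum>a<length vs. vec_index (Matrix.row (cov_mat S [s] vs * inv_mat (cov_mat S vs vs)) 0) a * z (vs ! a))"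
  by (simp add: cond_mean_def scalar_prod_def atLeast0LessThan)

lemma cond_mean_cong:
  "(\<And>v. v \<in> set vs \<Longrightarrow> z v = z' v) \<Longrightarrow> cond_mean S vs z s = cond_mean S vs z' s"
  by (simp add: cond_mean_eq_sum)

lemma cond_mean_diff: "cond_mean S vs (\<lambda>v. y v - z v) s = cond_mean S vs y s - cond_mean S vs z s"
  by (simp add: cond_mean_eq_sum algebra_simps sum_subtractf)

lemma borel_measurable_cond_mean [measurable (raw)]:
  assumes "\<And>v. v \<in> set vs \<Longrightarrow> (\<lambda>\<omega>. X \<omega> v) \<in> borel_measurable M"
  shows "(\<lambda>\<omega>. cond_mean S vs (X \<omega>) s) \<in> borel_measurable M"
proof -
  have [measurable]: "(\<lambda>\<omega>. X \<omega> (vs ! a)) \<in> borel_measurable M" if "a < length vs" for a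
    using assms that by simp
  show ?thesis unfolding cond_mean_eq_sum by measurable
qed

text \<open>On boxes this is one-dimensional translation invariance in each coordinate. It is used
  to absorb a change of conditional mean.\<close>

lemma distr_PiM_lborel_translate:
  assumes "finite J"
  shows "distr (PiM J (\<lambda>_. lborel)) (PiM J (\<lambda>_. lborel)) (\<lambda>g. \<lambda>j\<in>J. g j + c j) =
    PiM J (\<lambda>_. lborel :: real measure)"
proof -
  interpret product_sigma_finite "\<lambda>_. lborel :: real measure" by (rule product_sigma_finite_lborel)
  have meas: "(\<lambda>g. \<lambda>j\<in>J. g j + c j) \<in> PiM J (\<lambda>_. lborel) \<rightarrow>\<^sub>M PiM J (\<lambda>_. lborel)"
    by measurable
  show ?thesis
  proof (rule PiM_eqI)
    fix A :: "'a \<Rightarrow> real set" assume A: "\<And>j. j \<in> J \<Longrightarrow> A j \<in> sets lborel"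
    let ?A = "\<lambda>j. (\<lambda>x. c j + x) -` A j"
    have A': "?A j \<in> sets lborel" if "j \<in> J" for j
      using measurable_sets[of "\<lambda>x. c j + x" lborel lborel "A j"] A[OF that] by simp
    have "emeasure lborel (A j) = emeasure lborel (?A j)" if "j \<in> J" for j
    proof -
      have "emeasure lborel (A j) = emeasure (distr lborel borel ((+) (c j))) (A j)"
        by (simp add: lborel_distr_plus)
      also have "\<dots> = emeasure lborel (?A j)"
        using A[OF that] by (subst emeasure_distr) auto
      finally show ?thesis .
    qed
    moreover have "(\<lambda>g. \<lambda>j\<in>J. g j + c j) -` Pi\<^sub>E J A \<inter> space (PiM J (\<lambda>_. lborel)) = Pi\<^sub>E J ?A"
      by (auto simp: space_PiM PiE_iff add.commute)
    ultimately show "emeasure (distr (PiM J (\<lambda>_. lborel)) (PiM J (\<lambda>_. lborel)) (\<lambda>g. \<lambda>j\<in>J. g j + c j)) (Pi\<^sub>E J A) =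
        (\<Prod>j\<in>J. emeasure lborel (A j))"
      using assms A A' meas by (subst emeasure_distr) (auto intro!: sets_PiM_I_finite simp: emeasure_PiM)
  qed (use assms in auto)
qed

lemma nn_integral_PiM_lborel_translate:
  assumes "finite J" "F \<in> borel_measurable (PiM J (\<lambda>_. lborel))"
  shows "(\<integral>\<^sup>+g. F (\<lambda>j\<in>J. g j + c j) \<partial>PiM J (\<lambda>_. lborel :: real measure)) = (\<integral>\<^sup>+g. F g \<partial>PiM J (\<lambda>_. lborel))"
  using assms by (subst (2) distr_PiM_lborel_translate[OF assms(1), of c, symmetric])
    (subst nn_integral_distr, auto)

lemma gaussian_density_append_mean:
  assumes pd: "pd_on S (as @ bs)"
  shows "gaussian_density (as @ bs) m S z = gaussian_density as m S z *
    gaussian_density bs (\<lambda>s. m s + cond_mean S as (\<lambda>j. z j - m j) s) (cond_cov S as) z"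
proof -
  let ?y = "\<lambda>j. z j - m j"
  have "gaussian_density (as @ bs) m S z = gaussian_density (as @ bs) (\<lambda>_. 0) S ?y"
    by (rule gaussian_density_shift)
  also have "\<dots> = gaussian_density as (\<lambda>_. 0) S ?y * gaussian_density bs (cond_mean S as ?y) (cond_cov S as) ?y"
    by (rule gaussian_density_append[OF pd])
  also have "gaussian_density as (\<lambda>_. 0) S ?y = gaussian_density as m S z"
    by (rule gaussian_density_shift[symmetric])
  also have "gaussian_density bs (cond_mean S as ?y) (cond_cov S as) ?y =
      gaussian_density bs (\<lambda>s. m s + cond_mean S as ?y s) (cond_cov S as) z"
    by (intro gaussian_density_cong) simp
  finally show ?thesis .
qed

section \<open>Marginals, normalisation and second moments\<close>

lemma cond_cov_pos:
  assumes "pd_on S (js @ [a])"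
  shows "0 < cond_cov S js a a"
  using pd_on_cond_cov[OF assms] by (simp add: pd_on_singleton)

lemma gaussian_density_snoc:
  assumes "pd_on S (js @ [a])"
  shows "gaussian_density (js @ [a]) m S z = gaussian_density js m S z *
    normal_density (m a + cond_mean S js (\<lambda>j. z j - m j) a) (sqrt (cond_cov S js a a)) (z a)"
  using gaussian_density_append_mean[OF assms]
    gaussian_density_singleton[where S = "cond_cov S js" and a = a, OF cond_cov_pos[OF assms]] by simp

lemma nn_integral_normal_density: "0 < \<sigma> \<Longrightarrow> (\<integral>\<^sup>+x. ennreal (normal_density \<mu> \<sigma> x) \<partial>lborel) = 1"
  by (subst nn_integral_eq_integral) (auto simp: normal_density_nonneg)

text \<open>Given the other coordinates, the last one is normal with positive variance and a mean
  free of \<open>z a\<close>, so its density integrates to one. The first version feeds the iterated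
  integrals, the second matches the marginal in the theorem.\<close>

lemma
  assumes pd: "pd_on S (js @ [a])" and a: "a \<notin> set js"
  shows nn_integral_gaussian_density_snoc:
      "(\<integral>\<^sup>+t. ennreal (gaussian_density (js @ [a]) m S (z(a := t))) \<partial>lborel) = ennreal (gaussian_density js m S z)"
    and integral_gaussian_density_snoc:
      "(LINT t|lborel. gaussian_density (js @ [a]) m S (z(a := t))) = gaussian_density js m S z"
proof -
  have eq: "gaussian_density (js @ [a]) m S (z(a := t)) = gaussian_density js m S z *
      normal_density (m a + cond_mean S js (\<lambda>j. z j - m j) a) (sqrt (cond_cov S js a a)) t" for t
  proof -
    have "gaussian_density js m S (z(a := t)) = gaussian_density js m S z"
      using a by (intro gaussian_density_cong) auto
    moreover have "cond_mean S js (\<lambda>j. (z(a := t)) j - m j) a = cond_mean S js (\<lambda>j. z j - m j) a"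
      using a by (intro cond_mean_cong) auto
    ultimately show ?thesis by (simp add: gaussian_density_snoc[OF pd])
  qed
  have \<sigma>: "0 < sqrt (cond_cov S js a a)" using cond_cov_pos[OF pd] by simp
  have pos: "0 < gaussian_density js m S z" by (rule gaussian_density_pos[OF pd_on_appendD1[OF pd]])
  show "(\<integral>\<^sup>+t. ennreal (gaussian_density (js @ [a]) m S (z(a := t))) \<partial>lborel) = ennreal (gaussian_density js m S z)"
    using \<sigma> pos by (simp add: eq ennreal_mult normal_density_nonneg nn_integral_cmult nn_integral_normal_density)
  show "(LINT t|lborel. gaussian_density (js @ [a]) m S (z(a := t))) = gaussian_density js m S z"
    using \<sigma> by (simp add: eq)
qed

lemma gaussian_density_measurable_PiM:
  assumes "pd_on S js"
  shows "gaussian_density js m S \<in> borel_measurable (PiM (set js) (\<lambda>_. lborel))"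
  by (intro borel_measurable_gaussian_density[OF assms]) measurable

lemma nn_integral_gaussian_density:
  assumes "pd_on S js" "distinct js"
  shows "(\<integral>\<^sup>+z. ennreal (gaussian_density js m S z) \<partial>PiM (set js) (\<lambda>_. lborel)) = 1"
  using assms
proof (induction js rule: rev_induct)
  case Nil
  interpret product_sigma_finite "\<lambda>_. lborel :: real measure" by (rule product_sigma_finite_lborel)
  show ?case
    using Nil det_dim_zero[of "cov_mat S [] []"] cov_mat_carrier[of S "[]" "[]"]
    by (simp add: gaussian_density_eq_sum PiM_empty nn_integral_count_space_finite)
next
  case (snoc a js)
  interpret product_sigma_finite "\<lambda>_. lborel :: real measure" by (rule product_sigma_finite_lborel)
  have "(\<lambda>z. ennreal (gaussian_density (js @ [a]) m S z)) \<in> borel_measurable (PiM (insert a (set js)) (\<lambda>_. lborel))"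
    using gaussian_density_measurable_PiM[OF snoc.prems(1)] by simp
  then show ?case
    using snoc pd_on_appendD1[of S js "[a]"]
    by (simp add: product_nn_integral_insert nn_integral_gaussian_density_snoc)
qed

text \<open>With \<open>i\<close> moved to the front, the other coordinates integrate to one for
  every value of coordinate \<open>i\<close>, although their conditional mean depends on it. What
  remains is the second central moment of a normal variable.\<close>

lemma nn_integral_gaussian_density_square:
  assumes pd: "pd_on S js" and js: "distinct js" and i: "i \<in> set js"
  shows "(\<integral>\<^sup>+z. ennreal ((z i - m i)\<^sup>2) * ennreal (gaussian_density js m S z) \<partial>PiM (set js) (\<lambda>_. lborel)) < \<infinity>"
proof -
  interpret product_sigma_finite "\<lambda>_. lborel :: real measure" by (rule product_sigma_finite_lborel)
  define rest where "rest = removeAll i js"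
  have rest: "distinct ([i] @ rest)" "set ([i] @ rest) = set js" "insert i (set rest) = set js" "i \<notin> set rest"
    using js i by (auto simp: rest_def distinct_removeAll)
  have pd': "pd_on S ([i] @ rest)"
    by (rule pd_on_set_mono[OF pd js rest(1)]) (simp only: rest(2) order_refl)
  have pos: "0 < S i i" using pd_on_appendD1[OF pd'] by (simp add: pd_on_singleton)
  note pdc = pd_on_cond_cov[OF pd']
  let ?\<mu> = "\<lambda>y s. m s + cond_mean S [i] (\<lambda>j. y - m j) s"
  have split: "gaussian_density js m S (x(i := y)) =
      normal_density (m i) (sqrt (S i i)) y * gaussian_density rest (?\<mu> y) (cond_cov S [i]) x" for x y
  proof -
    have "gaussian_density js m S (x(i := y)) = gaussian_density ([i] @ rest) m S (x(i := y))"
      using gaussian_density_permute[OF pd js rest(1,2)] by simp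
    also have "\<dots> = normal_density (m i) (sqrt (S i i)) y *
      gaussian_density rest (\<lambda>s. m s + cond_mean S [i] (\<lambda>j. (x(i := y)) j - m j) s) (cond_cov S [i]) (x(i := y))"
      unfolding gaussian_density_append_mean[OF pd'] by (simp add: gaussian_density_singleton[where S = S and a = i, OF pos])
    also have "gaussian_density rest (\<lambda>s. m s + cond_mean S [i] (\<lambda>j. (x(i := y)) j - m j) s) (cond_cov S [i]) (x(i := y))
      = gaussian_density rest (?\<mu> y) (cond_cov S [i]) x"
      using rest(4) by (intro gaussian_density_cong) (auto simp: cond_mean_eq_sum)
    finally show ?thesis .
  qed
  have meas: "(\<lambda>z. ennreal ((z i - m i)\<^sup>2) * ennreal (gaussian_density js m S z)) \<in>
      borel_measurable (PiM (insert i (set rest)) (\<lambda>_. lborel))"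
    using gaussian_density_measurable_PiM[OF pd] i unfolding rest(3) by measurable
  have "(\<integral>\<^sup>+z. ennreal ((z i - m i)\<^sup>2) * ennreal (gaussian_density js m S z) \<partial>PiM (insert i (set rest)) (\<lambda>_. lborel))
      = (\<integral>\<^sup>+y. \<integral>\<^sup>+x. ennreal ((y - m i)\<^sup>2) * ennreal (normal_density (m i) (sqrt (S i i)) y *
          gaussian_density rest (?\<mu> y) (cond_cov S [i]) x) \<partial>PiM (set rest) (\<lambda>_. lborel) \<partial>lborel)"
    using rest(4) by (subst product_nn_integral_insert_rev[OF _ _ meas]) (simp_all add: split)
  also have "\<dots> = (\<integral>\<^sup>+y. ennreal ((y - m i)\<^sup>2) * ennreal (normal_density (m i) (sqrt (S i i)) y) \<partial>lborel)"
  proof (intro nn_integral_cong)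
    fix y
    have "(\<integral>\<^sup>+x. ennreal ((y - m i)\<^sup>2) * ennreal (normal_density (m i) (sqrt (S i i)) y *
          gaussian_density rest (?\<mu> y) (cond_cov S [i]) x) \<partial>PiM (set rest) (\<lambda>_. lborel)) =
        (\<integral>\<^sup>+x. (ennreal ((y - m i)\<^sup>2) * ennreal (normal_density (m i) (sqrt (S i i)) y)) *
          ennreal (gaussian_density rest (?\<mu> y) (cond_cov S [i]) x) \<partial>PiM (set rest) (\<lambda>_. lborel))"
      using gaussian_density_pos[OF pdc] 
      by (intro nn_integral_cong) (simp add: ennreal_mult' normal_density_nonneg mult.assoc)
    also have "\<dots> = ennreal ((y - m i)\<^sup>2) * ennreal (normal_density (m i) (sqrt (S i i)) y)"
      using rest(1) gaussian_density_measurable_PiM[OF pdc] by (subst nn_integral_cmult) (auto simp: nn_integral_gaussian_density[OF pdc])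
    finally show "(\<integral>\<^sup>+x. ennreal ((y - m i)\<^sup>2) * ennreal (normal_density (m i) (sqrt (S i i)) y *
          gaussian_density rest (?\<mu> y) (cond_cov S [i]) x) \<partial>PiM (set rest) (\<lambda>_. lborel)) =
        ennreal ((y - m i)\<^sup>2) * ennreal (normal_density (m i) (sqrt (S i i)) y)" .
  qed
  also have "\<dots> = (\<integral>\<^sup>+y. ennreal (normal_density (m i) (sqrt (S i i)) y * (y - m i)\<^sup>2) \<partial>lborel)"
    by (intro nn_integral_cong) (simp add: ennreal_mult'' mult.commute)
  also have "\<dots> < \<infinity>"
    using integrable_normal_moment[of "sqrt (S i i)" "m i" 2] pos
    by (subst nn_integral_eq_integral) (auto simp: normal_density_nonneg)
  finally show ?thesis unfolding rest(3) .
qed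

text \<open>The logarithm is a quadratic polynomial, so second moments suffice whatever the law of
  \<open>X\<close>; mixed products are dominated by sums of squares. Thus one Gaussian density can
  be tested under the law built from another.\<close>

lemma (in prob_space) integrable_ln_gaussian_density:
  assumes pd: "pd_on S js"
    and meas: "\<And>j. j \<in> set js \<Longrightarrow> (\<lambda>\<omega>. X \<omega> j) \<in> borel_measurable M"
    and sq: "\<And>j. j \<in> set js \<Longrightarrow> integrable M (\<lambda>\<omega>. (X \<omega> j)\<^sup>2)"
  shows "integrable M (\<lambda>\<omega>. ln (gaussian_density js m S (X \<omega>)))"
proof -
  let ?D = "sqrt ((2 * pi) ^ length js * Determinant.det (cov_mat S js js))"
  have D: "0 < ?D" using det_cov_mat_pos[OF pd] by simp
  have sq': "integrable M (\<lambda>\<omega>. (X \<omega> i - m i)\<^sup>2)" if "i \<in> set js" for i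
  proof (rule Bochner_Integration.integrable_bound)
    show "integrable M (\<lambda>\<omega>. 2 * (X \<omega> i)\<^sup>2 + 2 * (m i)\<^sup>2)" using sq[OF that] by simp
    show "(\<lambda>\<omega>. (X \<omega> i - m i)\<^sup>2) \<in> borel_measurable M" using meas[OF that] by measurable
    show "AE \<omega> in M. norm ((X \<omega> i - m i)\<^sup>2) \<le> norm (2 * (X \<omega> i)\<^sup>2 + 2 * (m i)\<^sup>2)"
    proof (intro AE_I2)
      fix \<omega>
      have "0 \<le> (X \<omega> i + m i)\<^sup>2" by simp
      then have "(X \<omega> i - m i)\<^sup>2 \<le> 2 * (X \<omega> i)\<^sup>2 + 2 * (m i)\<^sup>2"
        by (simp add: power2_sum power2_diff)
      then show "norm ((X \<omega> i - m i)\<^sup>2) \<le> norm (2 * (X \<omega> i)\<^sup>2 + 2 * (m i)\<^sup>2)"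
        by simp
    qed
  qed
  have prod: "integrable M (\<lambda>\<omega>. (X \<omega> i - m i) * (X \<omega> j - m j))" if "i \<in> set js" "j \<in> set js" for i j
  proof (rule Bochner_Integration.integrable_bound)
    show "integrable M (\<lambda>\<omega>. (X \<omega> i - m i)\<^sup>2 + (X \<omega> j - m j)\<^sup>2)"
      using sq'[OF that(1)] sq'[OF that(2)] by simp
    show "(\<lambda>\<omega>. (X \<omega> i - m i) * (X \<omega> j - m j)) \<in> borel_measurable M"
      using meas[OF that(1)] meas[OF that(2)] by measurable
    have "\<bar>a * b\<bar> \<le> a\<^sup>2 + b\<^sup>2" for a b :: real
    proof -
      have "0 \<le> (\<bar>a\<bar> - \<bar>b\<bar>)\<^sup>2" by simp
      then have "2 * \<bar>a * b\<bar> \<le> a\<^sup>2 + b\<^sup>2" by (simp add: power2_diff abs_mult)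
      then show ?thesis by simp
    qed
    then show "AE \<omega> in M. norm ((X \<omega> i - m i) * (X \<omega> j - m j)) \<le> norm ((X \<omega> i - m i)\<^sup>2 + (X \<omega> j - m j)\<^sup>2)"
      by (intro AE_I2) (simp add: abs_of_nonneg)
  qed
  have "ln (gaussian_density js m S z) =
    - (\<Sum>a<length js. \<Sum>b<length js. inv_mat (cov_mat S js js) $$ (a, b) *
        ((z (js ! a) - m (js ! a)) * (z (js ! b) - m (js ! b)))) / 2 - ln ?D" for z
    unfolding gaussian_density_eq_sum[OF pd] using D by (subst ln_divide_pos) simp_all
  moreover have "integrable M (\<lambda>\<omega>. - (\<Sum>a<length js. \<Sum>b<length js. inv_mat (cov_mat S js js) $$ (a, b) *
        ((X \<omega> (js ! a) - m (js ! a)) * (X \<omega> (js ! b) - m (js ! b)))) / 2 - ln ?D)"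
    using prod by (intro Bochner_Integration.integrable_diff integrable_divide integrable_minus
        Bochner_Integration.integrable_sum integrable_mult_right) auto
  ultimately show ?thesis by simp
qed

section \<open>From almost everywhere to everywhere\<close>

lemma continuous_AE_lborel_zero:
  fixes g :: "real \<Rightarrow> real"
  assumes "continuous_on UNIV g" "AE t in lborel. g t = 0"
  shows "g t = 0"
proof (rule ccontr)
  assume "g t \<noteq> 0"
  let ?U = "{t. g t \<noteq> 0}"
  have "open ?U" using assms(1) by (rule open_Collect_neq) simp
  moreover have "?U \<noteq> {}" using \<open>g t \<noteq> 0\<close> by auto
  moreover have "negligible ?U"
  proof -
    have "AE t in lebesgue. t \<notin> ?U" using AE_completion[OF assms(2)] by simp
    moreover have "?U \<in> sets lebesgue" using \<open>open ?U\<close> by auto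
    ultimately have "?U \<in> null_sets lebesgue" by (simp add: AE_iff_null_sets)
    then show ?thesis by (simp add: negligible_iff_null_sets)
  qed
  ultimately show False using open_not_negligible by blast
qed

text \<open>Continuity in one coordinate at a time suffices, so no topology on the product is
  involved. By Fubini almost every slice in coordinate \<open>i\<close> vanishes almost everywhere,
  hence identically; fixing that coordinate leaves a function on the smaller product.\<close>

lemma separately_continuous_AE_PiM_zero:
  fixes G :: "('i \<Rightarrow> real) \<Rightarrow> real"
  assumes "finite J" "G \<in> borel_measurable (PiM J (\<lambda>_. lborel))"
    and "\<And>z j. j \<in> J \<Longrightarrow> continuous_on UNIV (\<lambda>t. G (z(j := t)))"
    and "AE z in PiM J (\<lambda>_. lborel). G z = 0"
  shows "\<forall>z\<in>space (PiM J (\<lambda>_. lborel :: real measure)). G z = 0"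
  using assms
proof (induction J arbitrary: G rule: finite_induct)
  case empty
  then have "AE z in count_space {\<lambda>_. undefined}. G z = 0" by (simp only: PiM_empty)
  then have "G (\<lambda>_. undefined) = 0" by (simp add: AE_count_space)
  then show ?case by (simp add: space_PiM)
next
  case (insert i J)
  interpret product_sigma_finite "\<lambda>_. lborel :: real measure" by (rule product_sigma_finite_lborel)
  interpret J: sigma_finite_measure "PiM J (\<lambda>_. lborel :: real measure)"
    using insert.hyps(1) by (rule sigma_finite)
  note [measurable] = insert.prems(1)
  have "(\<integral>\<^sup>+z. ennreal \<bar>G z\<bar> \<partial>PiM (insert i J) (\<lambda>_. lborel)) = 0"
    using insert.prems(3) by (subst nn_integral_0_iff_AE) auto
  then have "(\<integral>\<^sup>+x. \<integral>\<^sup>+t. ennreal \<bar>G (x(i := t))\<bar> \<partial>lborel \<partial>PiM J (\<lambda>_. lborel)) = 0"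
    using insert.hyps by (subst (asm) product_nn_integral_insert) auto
  then have "AE x in PiM J (\<lambda>_. lborel). (\<integral>\<^sup>+t. ennreal \<bar>G (x(i := t))\<bar> \<partial>lborel) = 0"
    by (subst (asm) nn_integral_0_iff_AE) auto
  \<comment> \<open>The quantifier over \<open>t\<close> sits inside: the exceptional null set does
    not depend on \<open>t\<close>, so the induction hypothesis applies at each fixed
    \<open>t\<close>.\<close>
  then have all: "AE x in PiM J (\<lambda>_. lborel). \<forall>t. G (x(i := t)) = 0"
  proof (rule AE_mp, intro AE_I2 impI allI)
    fix x t assume x: "x \<in> space (PiM J (\<lambda>_. lborel :: real measure))"
      and 0: "(\<integral>\<^sup>+t. ennreal \<bar>G (x(i := t))\<bar> \<partial>lborel) = 0"
    have [measurable]: "(\<lambda>t. G (x(i := t))) \<in> borel_measurable lborel"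
      using x by measurable
    have "AE t in lborel. G (x(i := t)) = 0"
      using 0 by (subst (asm) nn_integral_0_iff_AE) auto
    then show "G (x(i := t)) = 0"
      by (rule continuous_AE_lborel_zero[rotated]) (rule insert.prems(2), simp)
  qed
  have zero: "\<forall>z\<in>space (PiM J (\<lambda>_. lborel :: real measure)). G (z(i := t)) = 0" for t
  proof (rule insert.IH)
    show "(\<lambda>z. G (z(i := t))) \<in> borel_measurable (PiM J (\<lambda>_. lborel))" by measurable
    show "continuous_on UNIV (\<lambda>s. G ((z(j := s))(i := t)))" if "j \<in> J" for z j
    proof -
      have "i \<noteq> j" using that insert.hyps by auto
      then show ?thesis
        using insert.prems(2)[of j "z(i := t)"] that by (simp add: fun_upd_twist[of j i] del: fun_upd_apply)
    qed
    show "AE z in PiM J (\<lambda>_. lborel). G (z(i := t)) = 0" using all by auto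
  qed
  show ?case
  proof
    fix z assume "z \<in> space (PiM (insert i J) (\<lambda>_. lborel :: real measure))"
    then have "restrict z J \<in> space (PiM J (\<lambda>_. lborel :: real measure))" "z = (restrict z J)(i := z i)"
      by (auto simp: space_PiM PiE_iff extensional_def fun_eq_iff)
    then show "G z = 0" using zero[of "z i"] by metis
  qed
qed

section \<open>State and function values as one product space\<close>

lemma emeasure_lborel_vec_product:
  fixes A :: "'d::finite \<Rightarrow> real set"
  assumes "\<And>i. A i \<in> sets borel"
  shows "emeasure lborel {x :: real ^ 'd. \<forall>i. vec_nth x i \<in> A i} = (\<Prod>i\<in>UNIV. emeasure lborel (A i))"
proof -
  interpret product_sigma_finite "\<lambda>_. lborel :: real measure" by (rule product_sigma_finite_lborel)
  \<comment> \<open>\<open>lborel\<close> is the image of a product measure over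
    \<open>Basis\<close>; the axis vectors identify \<open>Basis\<close> with the index type, which
    turns conditions on components into a box.\<close>
  have Basis: "(Basis :: (real ^ 'd) set) = range (\<lambda>i. axis i 1)"
    by (auto simp: Basis_vec_def)
  have inj: "inj (\<lambda>i :: 'd. axis i (1 :: real))" by (auto simp: inj_on_def axis_eq_axis)
  let ?F = "\<lambda>f. \<Sum>b\<in>(Basis :: (real ^ 'd) set). f b *\<^sub>R b"
  have F: "vec_nth (?F f) i = f (axis i 1)" for f i
  proof -
    have "vec_nth (?F f) i = inner (?F f) (axis i 1)" by (simp add: inner_axis)
    also have "\<dots> = f (axis i 1)" by (simp add: axis_in_Basis_iff)
    finally show ?thesis .
  qed
  define A' where "A' b = A (the_inv (\<lambda>i. axis i (1::real)) b)" for b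
  have A': "A' (axis i 1) = A i" for i unfolding A'_def by (simp add: the_inv_f_f[OF inj])
  have [measurable]: "{x :: real ^ 'd. \<forall>i. vec_nth x i \<in> A i} \<in> sets borel"
  proof -
    have "{x :: real ^ 'd. \<forall>i. vec_nth x i \<in> A i} = (\<Inter>i\<in>UNIV. (\<lambda>x. vec_nth x i) -` A i \<inter> space borel)"
      by auto
    also have "\<dots> \<in> sets borel"
      using assms by (intro sets.finite_INT measurable_sets[of _ _ borel]) 
        (auto intro: borel_measurable_continuous_onI continuous_intros)
    finally show ?thesis .
  qed
  have "emeasure lborel {x :: real ^ 'd. \<forall>i. vec_nth x i \<in> A i} =
      emeasure (PiM Basis (\<lambda>_. lborel)) (?F -` {x. \<forall>i. vec_nth x i \<in> A i} \<inter> space (PiM Basis (\<lambda>_. lborel)))"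
    by (subst lborel_eq, subst emeasure_distr) auto
  also have "?F -` {x. \<forall>i. vec_nth x i \<in> A i} \<inter> space (PiM Basis (\<lambda>_. lborel)) = Pi\<^sub>E Basis A'"
    using F A' by (auto simp: space_PiM PiE_iff Basis)
  also have "emeasure (PiM Basis (\<lambda>_. lborel)) (Pi\<^sub>E Basis A') = (\<Prod>b\<in>Basis. emeasure lborel (A' b))"
    using assms by (subst emeasure_PiM) (auto simp: A'_def)
  also have "\<dots> = (\<Prod>i\<in>UNIV. emeasure lborel (A i))"
    unfolding Basis using inj by (simp add: prod.reindex A')
  finally show ?thesis .
qed

definition joint_coord :: "(real ^ 'd) \<times> ('s \<Rightarrow> real) \<Rightarrow> 'd + 's \<Rightarrow> real" where
  "joint_coord = (\<lambda>(x, v). case_sum (\<lambda>i. vec_nth x i) v)"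

lemma joint_coord_simps [simp]:
  "joint_coord (x, v) (Inl i) = vec_nth x i" "joint_coord (x, v) (Inr s) = v s"
  by (simp_all add: joint_coord_def)

text \<open>Transports integrals over state and function values to the single product on which
  Gaussian densities are integrated. The restriction is there because points of \<open>PiM\<close>
  are \<open>undefined\<close> off the index set; boxes factor over coordinates on both
  sides.\<close>

lemma distr_joint_coord:
  assumes "finite V"
  defines "J \<equiv> range Inl \<union> Inr ` V"
  shows "distr (lborel \<Otimes>\<^sub>M PiM V (\<lambda>_. lborel)) (PiM J (\<lambda>_. lborel))
      (\<lambda>w :: (real ^ 'd) \<times> ('s \<Rightarrow> real). restrict (joint_coord w) J) = PiM J (\<lambda>_. lborel)"
    (is "distr ?B _ ?\<psi> = _")
    and "(\<lambda>w :: (real ^ 'd) \<times> ('s \<Rightarrow> real). restrict (joint_coord w) J) \<in>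
      lborel \<Otimes>\<^sub>M PiM V (\<lambda>_. lborel) \<rightarrow>\<^sub>M PiM J (\<lambda>_. lborel)"
proof -
  interpret product_sigma_finite "\<lambda>_::'d + 's. lborel :: real measure" by (rule product_sigma_finite_lborel)
  interpret S: product_sigma_finite "\<lambda>_::'s. lborel :: real measure" by (rule product_sigma_finite_lborel)
  interpret V: sigma_finite_measure "PiM V (\<lambda>_. lborel :: real measure)"
    using assms(1) by (rule S.sigma_finite)
  have [measurable]: "(\<lambda>x :: real ^ 'd. vec_nth x i) \<in> borel_measurable borel" for i
    by (intro borel_measurable_continuous_onI continuous_intros)
  show meas: "?\<psi> \<in> ?B \<rightarrow>\<^sub>M PiM J (\<lambda>_. lborel)"
  proof (rule measurable_restrict)
    fix j assume "j \<in> J"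
    then consider i where "j = Inl i" | s where "j = Inr s" "s \<in> V" by (auto simp: J_def)
    then show "(\<lambda>w. joint_coord w j) \<in> ?B \<rightarrow>\<^sub>M lborel"
    proof cases
      case 1 then show ?thesis by (simp add: joint_coord_def split_beta')
    next
      case 2 then show ?thesis by (simp add: joint_coord_def split_beta')
    qed
  qed
  show "distr ?B (PiM J (\<lambda>_. lborel)) ?\<psi> = PiM J (\<lambda>_. lborel)"
  proof (rule PiM_eqI)
    fix A :: "'d + 's \<Rightarrow> real set" assume A: "\<And>j. j \<in> J \<Longrightarrow> A j \<in> sets lborel"
    have Al: "A (Inl i) \<in> sets borel" for i using A by (simp add: J_def)
    have Ar: "A (Inr s) \<in> sets lborel" if "s \<in> V" for s using A that by (simp add: J_def)
    have X: "{x :: real ^ 'd. \<forall>i. vec_nth x i \<in> A (Inl i)} \<in> sets lborel"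
    proof -
      have "{x :: real ^ 'd. \<forall>i. vec_nth x i \<in> A (Inl i)} = (\<Inter>i\<in>UNIV. (\<lambda>x. vec_nth x i) -` A (Inl i) \<inter> space borel)"
        by auto
      also have "\<dots> \<in> sets borel"
        using Al by (intro sets.finite_INT measurable_sets[of _ _ borel]) auto
      finally show ?thesis by simp
    qed
    have "?\<psi> -` Pi\<^sub>E J A \<inter> space ?B = {x. \<forall>i. vec_nth x i \<in> A (Inl i)} \<times> Pi\<^sub>E V (\<lambda>s. A (Inr s))"
      by (auto simp: J_def space_pair_measure space_PiM PiE_iff ball_Un)
    then have "emeasure (distr ?B (PiM J (\<lambda>_. lborel)) ?\<psi>) (Pi\<^sub>E J A) =
        emeasure ?B ({x. \<forall>i. vec_nth x i \<in> A (Inl i)} \<times> Pi\<^sub>E V (\<lambda>s. A (Inr s)))"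
      using A assms(1) meas by (subst emeasure_distr) (auto intro!: sets_PiM_I_finite simp: J_def)
    also have "\<dots> = emeasure lborel {x :: real ^ 'd. \<forall>i. vec_nth x i \<in> A (Inl i)} *
        emeasure (PiM V (\<lambda>_. lborel)) (Pi\<^sub>E V (\<lambda>s. A (Inr s)))"
      using X Ar assms(1) by (intro V.emeasure_pair_measure_Times) (auto intro!: sets_PiM_I_finite)
    also have "\<dots> = (\<Prod>i\<in>UNIV. emeasure lborel (A (Inl i))) * (\<Prod>s\<in>V. emeasure lborel (A (Inr s)))"
      using Ar assms(1) by (subst S.emeasure_PiM) (auto simp: emeasure_lborel_vec_product[OF Al])
    also have "\<dots> = (\<Prod>j\<in>J. emeasure lborel (A j))"
      unfolding J_def using assms(1) by (subst prod.union_disjoint) (auto simp: prod.reindex)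
    finally show "emeasure (distr ?B (PiM J (\<lambda>_. lborel)) ?\<psi>) (Pi\<^sub>E J A) = (\<Prod>j\<in>J. emeasure lborel (A j))" .
  qed (use assms in auto)
qed

section \<open>Conditional laws of Gaussian processes\<close>

lemma sets_PiM_lborel [measurable_cong]:
  "sets (PiM J (\<lambda>_. lborel :: real measure)) = sets (PiM J (\<lambda>_. borel))"
  by (intro sets_PiM_cong) auto

lemma space_PiM_lborel: "space (PiM J (\<lambda>_. lborel :: real measure)) = space (PiM J (\<lambda>_. borel))"
  by (rule sets_eq_imp_space_eq) (rule sets_PiM_lborel)

lemma gaussian_process_unique:
  assumes P: "gaussian_process I m S P" and Q: "gaussian_process I m S Q"
  shows "P = Q"
proof (rule measure_eqI_PiM_infinite)
  show setsP: "sets P = sets (PiM I (\<lambda>_. borel))" and setsQ: "sets Q = sets (PiM I (\<lambda>_. borel))"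
    using P Q by (auto simp: gaussian_process_def)
  show "finite_measure P" using P by (auto simp: gaussian_process_def prob_space_def)
  fix A :: "'a \<Rightarrow> real set" and J
  assume J: "finite J" "J \<subseteq> I" and A: "\<And>i. i \<in> J \<Longrightarrow> A i \<in> sets borel"
  obtain js where js: "distinct js" "set js = J" using finite_distinct_list[OF J(1)] by blast
  have E: "Pi\<^sub>E J A \<in> sets (PiM J (\<lambda>_. borel))" using J A by (intro sets_PiM_I_finite) auto
  have *: "emeasure R (prod_emb I (\<lambda>_. borel) J (Pi\<^sub>E J A)) =
      emeasure (distr R (PiM J (\<lambda>_. borel)) (\<lambda>f. restrict f J)) (Pi\<^sub>E J A)"
    if R: "sets R = sets (PiM I (\<lambda>_. borel))" for R
  proof -
    have "(\<lambda>f. restrict f J) \<in> R \<rightarrow>\<^sub>M PiM J (\<lambda>_. borel)"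
      using measurable_restrict_subset[OF J(2)] R by (simp cong: measurable_cong_sets)
    moreover have "space R = (\<Pi>\<^sub>E i\<in>I. space borel)" using sets_eq_imp_space_eq[OF R] by (simp add: space_PiM)
    ultimately show ?thesis using E by (subst emeasure_distr) (auto simp: prod_emb_def)
  qed
  show "emeasure P (prod_emb I (\<lambda>_. borel) J (Pi\<^sub>E J A)) = emeasure Q (prod_emb I (\<lambda>_. borel) J (Pi\<^sub>E J A))"
    unfolding *[OF setsP] *[OF setsQ]
    using P Q js J(2) unfolding gaussian_process_def by metis
qed

locale gp_prior =
  fixes K :: "'s \<Rightarrow> 's \<Rightarrow> real" and prior :: "('s \<Rightarrow> real) measure"
  assumes pd: "\<And>xs. distinct xs \<Longrightarrow> pd_on K xs"
    and prior: "gaussian_process UNIV (\<lambda>_. 0) K prior"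
begin

lemma sets_prior [measurable_cong]: "sets prior = sets (PiM UNIV (\<lambda>_. borel))"
  using prior by (simp add: gaussian_process_def)

lemma prob_space_prior: "prob_space prior"
  using prior by (simp add: gaussian_process_def)

lemma gaussian_density_merge:
  assumes "distinct (vs @ rest)"
  shows "gaussian_density (vs @ rest) (\<lambda>_. 0) K (merge (set vs) (set rest) (v, g)) =
    gaussian_density vs (\<lambda>_. 0) K v * gaussian_density rest (cond_mean K vs v) (cond_cov K vs) g"
proof -
  let ?w = "merge (set vs) (set rest) (v, g)"
  have "gaussian_density vs (\<lambda>_. 0) K ?w = gaussian_density vs (\<lambda>_. 0) K v"
    by (intro gaussian_density_cong) (simp add: merge_def)
  moreover have "cond_mean K vs ?w = cond_mean K vs v"
    by (intro ext cond_mean_cong) (simp add: merge_def)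
  moreover have "gaussian_density rest m (cond_cov K vs) ?w = gaussian_density rest m (cond_cov K vs) g" for m
    using assms by (intro gaussian_density_cong) (auto simp: merge_def)
  ultimately show ?thesis by (simp add: gaussian_density_append[OF pd[OF assms]])
qed

text \<open>Conditioning by kriging: replacing the conditional mean of a prior sample by the one that
  belongs to the prescribed values turns the prior into the conditional law.\<close>

definition cond_sample :: "'s list \<Rightarrow> ('s \<Rightarrow> real) \<Rightarrow> ('s \<Rightarrow> real) \<Rightarrow> 's \<Rightarrow> real" where
  "cond_sample vs v f = (\<lambda>s\<in>- set vs. f s + cond_mean K vs (\<lambda>j. v j - f j) s)"

lemma measurable_cond_sample [measurable]:
  "cond_sample vs v \<in> PiM UNIV (\<lambda>_. borel) \<rightarrow>\<^sub>M PiM (- set vs) (\<lambda>_. borel)"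
  unfolding cond_sample_def by measurable

text \<open>Under the prior, given values \<open>v'\<close> on \<open>vs\<close>, the other values
  are Gaussian about the conditional mean for \<open>v'\<close>, with a covariance free of
  \<open>v'\<close>. The correction recentres them at the conditional mean for \<open>v\<close>, so
  the result is the same for all \<open>v'\<close>, and \<open>v'\<close> integrates out with total
  mass one.\<close>

lemma gaussian_process_cond_sample:
  assumes vs: "distinct vs"
  shows "gaussian_process (- set vs) (cond_mean K vs v) (cond_cov K vs)
    (distr prior (PiM (- set vs) (\<lambda>_. borel)) (cond_sample vs v))"
  unfolding gaussian_process_def
proof (intro conjI allI impI)
  interpret prior: prob_space prior by (rule prob_space_prior)
  show "prob_space (distr prior (PiM (- set vs) (\<lambda>_. borel)) (cond_sample vs v))"
    by (rule prior.prob_space_distr) measurable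
next
  fix js assume "distinct js \<and> set js \<subseteq> - set vs"
  then have js: "distinct js" "set vs \<inter> set js = {}" "set js \<subseteq> - set vs" by auto
  interpret product_sigma_finite "\<lambda>_::'s. lborel :: real measure" by (rule product_sigma_finite_lborel)
  have dist: "distinct (vs @ js)" using vs js by simp
  let ?cm = "cond_mean K vs" and ?cc = "cond_cov K vs"
  note pdc = pd_on_cond_cov[OF pd[OF dist]]
  \<comment> \<open>On \<open>js\<close>, \<open>cond_sample\<close> depends only on the prior
    sample at \<open>vs\<close> and \<open>js\<close>. \<open>H\<close> is this dependence, so a
    finite-dimensional density of the prior is enough.\<close>
  define H where "H w = (\<lambda>s\<in>set js. w s + ?cm (\<lambda>j. v j - w j) s)" for w
  have H [measurable]: "H \<in> PiM (set vs \<union> set js) (\<lambda>_. borel) \<rightarrow>\<^sub>M PiM (set js) (\<lambda>_. borel)"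
    unfolding H_def by measurable
  have [measurable]: "(\<lambda>f. restrict f (set js)) \<in> PiM (- set vs) (\<lambda>_. borel) \<rightarrow>\<^sub>M PiM (set js) (\<lambda>_. borel)"
    using js(3) by (rule measurable_restrict_subset)
  have [measurable]: "(\<lambda>f. restrict f (set vs \<union> set js)) \<in> PiM UNIV (\<lambda>_. borel) \<rightarrow>\<^sub>M PiM (set vs \<union> set js) (\<lambda>_. borel)"
    by (rule measurable_restrict_subset) simp
  have "distr (distr prior (PiM (- set vs) (\<lambda>_. borel)) (cond_sample vs v)) (PiM (set js) (\<lambda>_. borel)) (\<lambda>f. restrict f (set js))
      = distr prior (PiM (set js) (\<lambda>_. borel)) (\<lambda>f. restrict (cond_sample vs v f) (set js))"
    by (subst distr_distr) (auto simp: comp_def)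
  also have "\<dots> = distr prior (PiM (set js) (\<lambda>_. borel)) (\<lambda>f. H (restrict f (set vs \<union> set js)))"
  proof (intro distr_cong refl)
    fix f
    have "?cm (\<lambda>j. v j - restrict f (set vs \<union> set js) j) s = ?cm (\<lambda>j. v j - f j) s" for s
      by (intro cond_mean_cong) simp
    then show "restrict (cond_sample vs v f) (set js) = H (restrict f (set vs \<union> set js))"
      using js(3) by (auto simp: H_def cond_sample_def fun_eq_iff restrict_def)
  qed
  also have "\<dots> = distr (distr prior (PiM (set vs \<union> set js) (\<lambda>_. borel)) (\<lambda>f. restrict f (set vs \<union> set js)))
      (PiM (set js) (\<lambda>_. borel)) H"
    by (subst distr_distr) (auto simp: comp_def)
  also have "distr prior (PiM (set vs \<union> set js) (\<lambda>_. borel)) (\<lambda>f. restrict f (set vs \<union> set js)) =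
      density (PiM (set vs \<union> set js) (\<lambda>_. lborel)) (\<lambda>z. ennreal (gaussian_density (vs @ js) (\<lambda>_. 0) K z))"
    using prior dist unfolding gaussian_process_def by (metis set_append subset_UNIV)
  also have "distr \<dots> (PiM (set js) (\<lambda>_. borel)) H =
      density (PiM (set js) (\<lambda>_. lborel)) (\<lambda>z. ennreal (gaussian_density js (?cm v) ?cc z))"
  proof (rule measure_eqI)
    fix E assume "E \<in> sets (distr (density (PiM (set vs \<union> set js) (\<lambda>_. lborel))
        (\<lambda>z. ennreal (gaussian_density (vs @ js) (\<lambda>_. 0) K z))) (PiM (set js) (\<lambda>_. borel)) H)"
    then have E [measurable]: "E \<in> sets (PiM (set js) (\<lambda>_. borel))" by simp
    have [measurable]: "gaussian_density (vs @ js) (\<lambda>_. 0) K \<in> borel_measurable (PiM (set vs \<union> set js) (\<lambda>_. borel))"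
      using gaussian_density_measurable_PiM[OF pd[OF dist], of "\<lambda>_. 0"]
      by (simp cong: measurable_cong_sets add: sets_PiM_lborel)
    have [measurable]: "gaussian_density js m ?cc \<in> borel_measurable (PiM (set js) (\<lambda>_. borel))" for m
      using gaussian_density_measurable_PiM[OF pdc, of m] by (simp cong: measurable_cong_sets add: sets_PiM_lborel)
    have [measurable]: "gaussian_density vs (\<lambda>_. 0) K \<in> borel_measurable (PiM (set vs) (\<lambda>_. borel))"
      using gaussian_density_measurable_PiM[OF pd[OF vs], of "\<lambda>_. 0"] by (simp cong: measurable_cong_sets add: sets_PiM_lborel)
    let ?F = "\<lambda>g. ennreal (gaussian_density js (?cm v) ?cc g) * indicator E g"
    let ?C = "\<integral>\<^sup>+g. ?F g \<partial>PiM (set js) (\<lambda>_. lborel)"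
    have inner: "(\<integral>\<^sup>+g. ennreal (gaussian_density (vs @ js) (\<lambda>_. 0) K (merge (set vs) (set js) (v', g))) *
          indicator E (H (merge (set vs) (set js) (v', g))) \<partial>PiM (set js) (\<lambda>_. lborel)) =
        ennreal (gaussian_density vs (\<lambda>_. 0) K v') * ?C" for v'
    proof -
      \<comment> \<open>For fixed \<open>v'\<close> the map \<open>H\<close> is translation by
        \<open>c\<close>, which takes the conditional mean for \<open>v'\<close> to that for
        \<open>v\<close>; translation invariance then removes \<open>v'\<close> from the inner
        integral.\<close>
      define c where "c s = ?cm v s - ?cm v' s" for s
      have Hm: "H (merge (set vs) (set js) (v', g)) = (\<lambda>s\<in>set js. g s + c s)" for g
      proof -
        have "?cm (\<lambda>j. v j - merge (set vs) (set js) (v', g) j) s = ?cm (\<lambda>j. v j - v' j) s" for s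
          by (intro cond_mean_cong) (simp add: merge_def)
        then show ?thesis
          using js(2) by (auto simp: H_def c_def cond_mean_diff fun_eq_iff restrict_def merge_def)
      qed
      have "gaussian_density js (?cm v') ?cc g = gaussian_density js (?cm v) ?cc (\<lambda>s\<in>set js. g s + c s)" for g
        by (intro gaussian_density_cong) (simp add: c_def)
      then have "(\<integral>\<^sup>+g. ennreal (gaussian_density (vs @ js) (\<lambda>_. 0) K (merge (set vs) (set js) (v', g))) *
          indicator E (H (merge (set vs) (set js) (v', g))) \<partial>PiM (set js) (\<lambda>_. lborel)) =
        (\<integral>\<^sup>+g. ennreal (gaussian_density vs (\<lambda>_. 0) K v') * ?F (\<lambda>s\<in>set js. g s + c s) \<partial>PiM (set js) (\<lambda>_. lborel))"
        by (intro nn_integral_cong) (simp add: gaussian_density_merge[OF dist] Hm ennreal_mult'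
            less_imp_le[OF gaussian_density_pos[OF pd[OF vs]]] mult.assoc)
      also have "\<dots> = ennreal (gaussian_density vs (\<lambda>_. 0) K v') *
          (\<integral>\<^sup>+g. ?F (\<lambda>s\<in>set js. g s + c s) \<partial>PiM (set js) (\<lambda>_. lborel))"
        by (intro nn_integral_cmult) measurable
      also have "(\<integral>\<^sup>+g. ?F (\<lambda>s\<in>set js. g s + c s) \<partial>PiM (set js) (\<lambda>_. lborel)) = ?C"
        by (rule nn_integral_PiM_lborel_translate) (auto, measurable)
      finally show ?thesis .
    qed
    have "emeasure (distr (density (PiM (set vs \<union> set js) (\<lambda>_. lborel))
        (\<lambda>z. ennreal (gaussian_density (vs @ js) (\<lambda>_. 0) K z))) (PiM (set js) (\<lambda>_. borel)) H) E =
      (\<integral>\<^sup>+w. ennreal (gaussian_density (vs @ js) (\<lambda>_. 0) K w) * indicator E (H w) \<partial>PiM (set vs \<union> set js) (\<lambda>_. lborel))"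
      by (subst nn_integral_indicator[symmetric], simp, subst nn_integral_distr, measurable)
        (subst nn_integral_density, measurable)
    also have "\<dots> = (\<integral>\<^sup>+v'. ennreal (gaussian_density vs (\<lambda>_. 0) K v') * ?C \<partial>PiM (set vs) (\<lambda>_. lborel))"
      by (subst product_nn_integral_fold[OF js(2)]) (simp_all add: inner)
    also have "\<dots> = ?C"
      by (subst nn_integral_multc) (simp_all add: nn_integral_gaussian_density[OF pd[OF vs] vs])
    finally show "emeasure (distr (density (PiM (set vs \<union> set js) (\<lambda>_. lborel))
        (\<lambda>z. ennreal (gaussian_density (vs @ js) (\<lambda>_. 0) K z))) (PiM (set js) (\<lambda>_. borel)) H) E =
      emeasure (density (PiM (set js) (\<lambda>_. lborel)) (\<lambda>z. ennreal (gaussian_density js (?cm v) ?cc z))) E"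
      by (subst emeasure_density) (auto simp: sets_PiM_lborel)
  qed (simp add: sets_PiM_lborel)
  finally show "distr (distr prior (PiM (- set vs) (\<lambda>_. borel)) (cond_sample vs v)) (PiM (set js) (\<lambda>_. borel)) (\<lambda>f. restrict f (set js))
      = density (PiM (set js) (\<lambda>_. lborel)) (\<lambda>z. ennreal (gaussian_density js (?cm v) ?cc z))" .
qed simp

lemma gp_conditional_eq:
  assumes "distinct vs"
  shows "gp_conditional K vs v = distr prior (PiM (- set vs) (\<lambda>_. borel)) (cond_sample vs v)"
  unfolding gp_conditional_def
proof (rule the_equality)
  show "gaussian_process (- set vs) (cond_mean K vs v) (cond_cov K vs)
      (distr prior (PiM (- set vs) (\<lambda>_. borel)) (cond_sample vs v))"
    by (rule gaussian_process_cond_sample[OF assms])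
  then show "gaussian_process (- set vs) (cond_mean K vs v) (cond_cov K vs) P \<Longrightarrow>
      P = distr prior (PiM (- set vs) (\<lambda>_. borel)) (cond_sample vs v)" for P
    by (intro gaussian_process_unique)
qed

lemma gaussian_process_gp_conditional:
  "distinct vs \<Longrightarrow> gaussian_process (- set vs) (cond_mean K vs v) (cond_cov K vs) (gp_conditional K vs v)"
  using gaussian_process_cond_sample gp_conditional_eq by simp

end

section \<open>Joint laws of state and process\<close>

text \<open>Rectangles determine the measure on the pair space, and cylinders determine the measure
  on function space. Only index sets containing \<open>V\<close> are tested because the densities of
  joint laws are computed only on sets containing the inducing points.\<close>

lemma joint_measure_eqI:
  fixes P Q :: "('x \<times> ('s \<Rightarrow> real)) measure" and X :: "'x measure"
  assumes sets: "sets P = sets (X \<Otimes>\<^sub>M PiM UNIV (\<lambda>_. borel))" "sets Q = sets (X \<Otimes>\<^sub>M PiM UNIV (\<lambda>_. borel))"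
    and fin: "finite_measure P" "finite_measure Q" and "finite V"
    and eq: "\<And>J. finite J \<Longrightarrow> V \<subseteq> J \<Longrightarrow>
      distr P (X \<Otimes>\<^sub>M PiM J (\<lambda>_. borel)) (\<lambda>(x, f). (x, restrict f J)) =
      distr Q (X \<Otimes>\<^sub>M PiM J (\<lambda>_. borel)) (\<lambda>(x, f). (x, restrict f J))"
  shows "P = Q"
proof -
  let ?F = "PiM UNIV (\<lambda>_::'s. borel :: real measure)"
  interpret P: finite_measure P by fact
  interpret Q: finite_measure Q by fact
  note [measurable_cong] = sets
  have space: "space P = space X \<times> UNIV" "space Q = space X \<times> UNIV"
    using sets[THEN sets_eq_imp_space_eq] by (simp_all add: space_pair_measure space_PiM)
  have rect: "emeasure P (A \<times> B) = emeasure Q (A \<times> B)" if A: "A \<in> sets X" and B: "B \<in> sets ?F" for A B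
  proof -
    \<comment> \<open>Fixing the side \<open>A\<close> of a rectangle leaves a finite measure on
      function space alone, where uniqueness for infinite products applies.\<close>
    define slice where "slice R = distr (density R (indicator (A \<times> UNIV))) ?F snd" for R :: "('x \<times> ('s \<Rightarrow> real)) measure"
    have AU: "A \<times> UNIV \<in> sets (X \<Otimes>\<^sub>M ?F)"
      using A sets.top[of ?F] by (intro pair_measureI) (auto simp: space_PiM)
    have slice: "emeasure (slice R) C = emeasure R (A \<times> C)"
      if R: "sets R = sets (X \<Otimes>\<^sub>M ?F)" and C: "C \<in> sets ?F" for R C
    proof -
      note [measurable_cong] = R
      note [measurable] = C
      have spR: "space R = space X \<times> UNIV"
        using R[THEN sets_eq_imp_space_eq] by (simp add: space_pair_measure space_PiM)
      have AC: "A \<times> C \<in> sets R" using A C R by simp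
      have AUR: "A \<times> UNIV \<in> sets R" using AU R by simp
      have "snd \<in> R \<rightarrow>\<^sub>M ?F" by measurable
      then have UC: "snd -` C \<inter> space R \<in> sets R" using C by (rule measurable_sets)
      have "emeasure (slice R) C = emeasure (density R (indicator (A \<times> UNIV))) (snd -` C \<inter> space R)"
        unfolding slice_def using C by (subst emeasure_distr) auto
      also have "\<dots> = (\<integral>\<^sup>+w. indicator (A \<times> UNIV) w * indicator (snd -` C \<inter> space R) w \<partial>R)"
        using AUR UC by (intro emeasure_density) auto
      also have "\<dots> = (\<integral>\<^sup>+w. indicator (A \<times> C) w \<partial>R)"
        using spR by (intro nn_integral_cong) (auto simp: indicator_def)
      finally show ?thesis using AC by simp
    qed
    have "slice P = slice Q"
    proof (rule measure_eqI_PiM_infinite[where I = UNIV and M = "\<lambda>_. borel"])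
      show "sets (slice P) = sets ?F" "sets (slice Q) = sets ?F" by (simp_all add: slice_def)
      show "finite_measure (slice P)"
      proof
        have "emeasure (slice P) (space ?F) = emeasure P (A \<times> space ?F)" using sets(1) by (rule slice) simp
        then show "emeasure (slice P) (space (slice P)) \<noteq> \<infinity>" by (simp add: slice_def)
      qed
      fix C :: "'s \<Rightarrow> real set" and J :: "'s set"
      assume J: "finite J" and C: "\<And>i. i \<in> J \<Longrightarrow> C i \<in> sets borel"
      \<comment> \<open>A cylinder over \<open>J\<close> is also one over
        \<open>J \<union> V\<close>, where the hypothesis can be used.\<close>
      let ?J = "J \<union> V" and ?C = "prod_emb UNIV (\<lambda>_. borel :: real measure) J (Pi\<^sub>E J C)"
      let ?E = "A \<times> prod_emb (J \<union> V) (\<lambda>_. borel :: real measure) J (Pi\<^sub>E J C)"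
      have C': "?C \<in> sets ?F" using J C by (intro sets_PiM_I) auto
      have E: "?E \<in> sets (X \<Otimes>\<^sub>M PiM ?J (\<lambda>_. borel))"
        using A J C by (intro pair_measureI sets_PiM_I) auto
      have *: "emeasure R (A \<times> ?C) = emeasure (distr R (X \<Otimes>\<^sub>M PiM ?J (\<lambda>_. borel)) (\<lambda>(x, f). (x, restrict f ?J))) ?E"
        if R: "sets R = sets (X \<Otimes>\<^sub>M ?F)" for R
      proof -
        note [measurable_cong] = R
        have spR: "space R = space X \<times> UNIV"
          using R[THEN sets_eq_imp_space_eq] by (simp add: space_pair_measure space_PiM)
        have [measurable]: "(\<lambda>f. restrict f ?J) \<in> ?F \<rightarrow>\<^sub>M PiM ?J (\<lambda>_. borel)"
          by (rule measurable_restrict_subset) simp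
        have m: "(\<lambda>(x, f). (x, restrict f ?J)) \<in> R \<rightarrow>\<^sub>M X \<Otimes>\<^sub>M PiM ?J (\<lambda>_. borel)" by measurable
        have "A \<times> ?C = (\<lambda>(x, f). (x, restrict f ?J)) -` ?E \<inter> space R"
          using sets.sets_into_space[OF A] by (auto simp: spR prod_emb_def PiE_iff)
        then show ?thesis using emeasure_distr[OF m E] by simp
      qed
      show "emeasure (slice P) ?C = emeasure (slice Q) ?C"
        unfolding slice[OF sets(1) C'] slice[OF sets(2) C'] *[OF sets(1)] *[OF sets(2)]
        using J assms(5) by (subst eq) auto
    qed
    then show ?thesis using slice[OF sets(1) B] slice[OF sets(2) B] by simp
  qed
  show ?thesis
  proof (rule measure_eqI_generator_eq[OF Int_stable_pair_measure_generator, of X ?F "space X \<times> space ?F" P Q "\<lambda>_. space X \<times> space ?F"])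
    show "{a \<times> b |a b. a \<in> sets X \<and> b \<in> sets ?F} \<subseteq> Pow (space X \<times> space ?F)"
      by (rule pair_measure_closed)
    show "sets P = sigma_sets (space X \<times> space ?F) {a \<times> b |a b. a \<in> sets X \<and> b \<in> sets ?F}"
      "sets Q = sigma_sets (space X \<times> space ?F) {a \<times> b |a b. a \<in> sets X \<and> b \<in> sets ?F}"
      using sets by (simp_all add: sets_pair_measure)
  qed (use rect P.emeasure_finite in auto)
qed

section \<open>Gaussian densities in state and inducing values\<close>

lemma is_gaussian_iff:
  "is_gaussian vs q \<longleftrightarrow> (\<exists>js m S. distinct js \<and> set js = range Inl \<union> Inr ` set vs \<and> pd_on S js \<and>
     q = (\<lambda>w. gaussian_density js m S (joint_coord w)))"
  unfolding is_gaussian_def joint_coord_def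
  using pd_onI pd_on_sym_psd invertible_cov by (fastforce simp: split_beta')

lemma is_gaussian_measurable_PiM:
  fixes q :: "(real ^ 'd) \<times> (real ^ 'd \<Rightarrow> real) \<Rightarrow> real"
  assumes "is_gaussian vs q" "set vs \<subseteq> J"
  shows "q \<in> borel_measurable (borel \<Otimes>\<^sub>M PiM J (\<lambda>_. borel))"
proof -
  obtain js m S where js: "set js = range Inl \<union> Inr ` set vs" "pd_on S js"
      and q: "q = (\<lambda>w. gaussian_density js m S (joint_coord w))"
    using assms(1) unfolding is_gaussian_iff by blast
  have [measurable]: "(\<lambda>x :: real ^ 'd. vec_nth x i) \<in> borel_measurable borel" for i
    by (intro borel_measurable_continuous_onI continuous_intros)
  show ?thesis
    unfolding q
  proof (rule borel_measurable_gaussian_density[OF js(2)])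
    fix j assume "j \<in> set js"
    then consider i where "j = Inl i" | s where "j = Inr s" "s \<in> J" using js(1) assms(2) by auto
    then show "(\<lambda>w. joint_coord w j - m j) \<in> borel_measurable (borel \<Otimes>\<^sub>M PiM J (\<lambda>_. borel))"
      by cases (simp_all add: joint_coord_def split_beta')
  qed
qed

lemma is_gaussian_pos:
  assumes "is_gaussian vs q"
  shows "0 < q w"
  using assms gaussian_density_pos unfolding is_gaussian_iff by blast

lemma is_gaussian_restrict:
  assumes "is_gaussian vs q" "set vs \<subseteq> J"
  shows "q (x, restrict v J) = q (x, v)"
proof -
  obtain js m S where js: "set js = range Inl \<union> Inr ` set vs"
      and q: "q = (\<lambda>w. gaussian_density js m S (joint_coord w))"
    using assms(1) unfolding is_gaussian_iff by blast
  show ?thesis unfolding q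
    using js assms(2) by (intro gaussian_density_cong) (auto simp: joint_coord_def)
qed

lemma nn_integral_joint_coord:
  fixes F :: "('d::finite + 's \<Rightarrow> real) \<Rightarrow> ennreal"
  assumes "finite V" "F \<in> borel_measurable (PiM (range Inl \<union> Inr ` V) (\<lambda>_. lborel))"
  shows "(\<integral>\<^sup>+w. F (restrict (joint_coord w) (range Inl \<union> Inr ` V)) \<partial>(lborel \<Otimes>\<^sub>M PiM V (\<lambda>_. lborel))) =
    (\<integral>\<^sup>+z. F z \<partial>PiM (range Inl \<union> Inr ` V) (\<lambda>_. lborel))"
  using nn_integral_distr[OF distr_joint_coord(2)[OF assms(1)], of F] assms(2)
  by (simp add: distr_joint_coord(1)[OF assms(1)])

lemma nn_integral_is_gaussian:
  assumes "is_gaussian vs q"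
  shows "(\<integral>\<^sup>+w. ennreal (q w) \<partial>(lborel \<Otimes>\<^sub>M PiM (set vs) (\<lambda>_. lborel))) = 1"
proof -
  obtain js m S where js: "distinct js" "set js = range Inl \<union> Inr ` set vs" "pd_on S js"
      and q: "q = (\<lambda>w. gaussian_density js m S (joint_coord w))"
    using assms(1) unfolding is_gaussian_iff by blast
  have "q w = gaussian_density js m S (restrict (joint_coord w) (set js))" for w
    unfolding q by (intro gaussian_density_cong) simp
  then have "(\<integral>\<^sup>+w. ennreal (q w) \<partial>(lborel \<Otimes>\<^sub>M PiM (set vs) (\<lambda>_. lborel))) =
      (\<integral>\<^sup>+z. ennreal (gaussian_density js m S z) \<partial>PiM (set js) (\<lambda>_. lborel))"
    using nn_integral_joint_coord[of "set vs" "\<lambda>z. ennreal (gaussian_density js m S z)"]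
      gaussian_density_measurable_PiM[OF js(3), of m] unfolding js(2) by simp
  then show ?thesis using nn_integral_gaussian_density[OF js(3,1)] by simp
qed

section \<open>Finite-dimensional densities of joint laws\<close>

locale gp_prior_state = gp_prior K prior
  for K :: "real ^ 'd \<Rightarrow> real ^ 'd \<Rightarrow> real" and prior
begin

abbreviation path_space :: "((real ^ 'd) \<times> (real ^ 'd \<Rightarrow> real)) measure" where
  "path_space \<equiv> borel \<Otimes>\<^sub>M PiM UNIV (\<lambda>_. borel)"

abbreviation gd_prior :: "(real ^ 'd) list \<Rightarrow> (real ^ 'd \<Rightarrow> real) \<Rightarrow> real" where
  "gd_prior vs \<equiv> gaussian_density vs (\<lambda>_. 0) K"

lemma merge_compl_eq: "merge V (- V) (v, g) = (\<lambda>i\<in>UNIV. if i \<in> V then v i else g i)"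
  by (auto simp: merge_def fun_eq_iff)

lemma measurable_merge_compl:
  "(\<lambda>g. (x, merge V (- V) (v, g))) \<in> PiM (- V) (\<lambda>_. borel) \<rightarrow>\<^sub>M path_space"
proof -
  have "(\<lambda>g. if i \<in> V then v i else g i) \<in> borel_measurable (PiM (- V) (\<lambda>_. borel :: real measure))" for i
    by (cases "i \<in> V") auto
  then have "(\<lambda>g. \<lambda>i\<in>UNIV. if i \<in> V then v i else g i) \<in> PiM (- V) (\<lambda>_. borel) \<rightarrow>\<^sub>M PiM UNIV (\<lambda>_. borel :: real measure)"
    by (intro measurable_restrict)
  then show ?thesis unfolding merge_compl_eq by (intro measurable_Pair) auto
qed

text \<open>Measurability in \<open>v\<close> is invisible in a \<open>THE\<close>. Rewritten
  through \<open>cond_sample\<close>, the kernel is the image of the fixed measure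
  \<open>prior\<close> under a jointly measurable map, and \<open>bind\<close> becomes
  computable.\<close>

lemma measurable_joint_kernel:
  assumes vs: "distinct vs"
  shows "(\<lambda>(x, v). distr (gp_conditional K vs v) path_space (\<lambda>g. (x, merge (set vs) (- set vs) (v, g))))
    \<in> lborel \<Otimes>\<^sub>M PiM (set vs) (\<lambda>_. lborel) \<rightarrow>\<^sub>M subprob_algebra path_space"
proof -
  let ?B = "lborel \<Otimes>\<^sub>M PiM (set vs) (\<lambda>_. lborel) :: ((real ^ 'd) \<times> (real ^ 'd \<Rightarrow> real)) measure"
  let ?h = "\<lambda>w f. (fst w, merge (set vs) (- set vs) (snd w, cond_sample vs (snd w) f))"
  interpret prior: prob_space prior by (rule prob_space_prior)
  have "distr (gp_conditional K vs v) path_space (\<lambda>g. (x, merge (set vs) (- set vs) (v, g))) =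
      distr prior path_space (?h (x, v))" for x v
    unfolding gp_conditional_eq[OF vs] using measurable_merge_compl
    by (subst distr_distr) (auto simp: comp_def)
  moreover have "(\<lambda>w. distr prior path_space (?h w)) \<in> ?B \<rightarrow>\<^sub>M subprob_algebra path_space"
  proof (rule measurable_distr2[where M = prior])
    have "(\<lambda>(w, f). if i \<in> set vs then snd w i else cond_sample vs (snd w) f i)
        \<in> borel_measurable (?B \<Otimes>\<^sub>M prior)" for i
    proof (cases "i \<in> set vs")
      case True
      then show ?thesis by simp
    next
      case False
      then show ?thesis by (simp add: cond_sample_def split_beta')
    qed
    then have "(\<lambda>p. \<lambda>i\<in>UNIV. if i \<in> set vs then snd (fst p) i else cond_sample vs (snd (fst p)) (snd p) i)
        \<in> ?B \<Otimes>\<^sub>M prior \<rightarrow>\<^sub>M PiM UNIV (\<lambda>_. borel)"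
      by (intro measurable_restrict) (simp add: split_beta')
    then show "case_prod ?h \<in> ?B \<Otimes>\<^sub>M prior \<rightarrow>\<^sub>M path_space"
      unfolding merge_compl_eq split_beta' by (intro measurable_Pair) auto
    show "(\<lambda>w. prior) \<in> ?B \<rightarrow>\<^sub>M subprob_algebra prior"
      using prior.M_in_subprob by simp
  qed
  ultimately show ?thesis by (simp add: split_beta')
qed

lemma sets_joint_law:
  assumes "distinct vs"
  shows "sets (joint_law K vs q) = sets path_space"
  unfolding joint_law_def
  by (rule sets_bind) (auto simp: space_pair_measure space_PiM PiE_eq_empty_iff)

text \<open>The kernel contributes the conditional density of the points of \<open>js\<close>
  outside \<open>vs\<close>. By the chain rule it equals a quotient of prior densities without
  conditional moments, which makes laws over different inducing sets comparable.\<close>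

lemma distr_joint_law:
  assumes vs: "distinct vs" and js: "distinct js" "set vs \<subseteq> set js" and q: "is_gaussian vs q"
  shows "distr (joint_law K vs q) (borel \<Otimes>\<^sub>M PiM (set js) (\<lambda>_. borel)) (\<lambda>(x, f). (x, restrict f (set js))) =
    density (lborel \<Otimes>\<^sub>M PiM (set js) (\<lambda>_. lborel))
      (\<lambda>w. ennreal (q w) * ennreal (gd_prior js (snd w) / gd_prior vs (snd w)))"
proof -
  interpret product_sigma_finite "\<lambda>_::real ^ 'd. lborel :: real measure" by (rule product_sigma_finite_lborel)
  define rest where "rest = filter (\<lambda>j. j \<notin> set vs) js"
  have rest: "distinct (vs @ rest)" "set vs \<inter> set rest = {}" "set vs \<union> set rest = set js" "set rest \<subseteq> - set vs"
    using vs js by (auto simp: rest_def)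
  interpret V: sigma_finite_measure "PiM (set vs) (\<lambda>_. lborel :: real measure)" by (rule sigma_finite) simp
  interpret R: sigma_finite_measure "PiM (set rest) (\<lambda>_. lborel :: real measure)" by (rule sigma_finite) simp
  interpret J: sigma_finite_measure "PiM (set js) (\<lambda>_. lborel :: real measure)" by (rule sigma_finite) simp
  let ?B = "lborel \<Otimes>\<^sub>M PiM (set vs) (\<lambda>_. lborel) :: ((real ^ 'd) \<times> (real ^ 'd \<Rightarrow> real)) measure"
  let ?BJ = "lborel \<Otimes>\<^sub>M PiM (set js) (\<lambda>_. lborel) :: ((real ^ 'd) \<times> (real ^ 'd \<Rightarrow> real)) measure"
  let ?N = "borel \<Otimes>\<^sub>M PiM (set js) (\<lambda>_. borel) :: ((real ^ 'd) \<times> (real ^ 'd \<Rightarrow> real)) measure"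
  let ?\<rho> = "\<lambda>(x, f). (x :: real ^ 'd, restrict f (set js) :: real ^ 'd \<Rightarrow> real)"
  let ?k = "\<lambda>(x, v). distr (gp_conditional K vs v) path_space (\<lambda>g. (x, merge (set vs) (- set vs) (v, g)))"
  let ?mg = "\<lambda>v h. merge (set vs) (set rest) (v, h)"
  note pdc = pd_on_cond_cov[OF pd[OF rest(1)]]
  have qB: "q \<in> borel_measurable ?B"
    using is_gaussian_measurable_PiM[OF q order_refl] by measurable
  have [measurable]: "q \<in> borel_measurable ?N"
    by (rule is_gaussian_measurable_PiM[OF q js(2)])
  have [measurable]: "gd_prior js \<in> borel_measurable (PiM (set js) (\<lambda>_. borel))"
    using gaussian_density_measurable_PiM[OF pd[OF js(1)], of "\<lambda>_. 0"]
    by (simp cong: measurable_cong_sets add: sets_PiM_lborel)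
  have [measurable]: "gd_prior vs \<in> borel_measurable (PiM (set js) (\<lambda>_. borel))"
    using js(2) by (intro borel_measurable_gaussian_density[OF pd[OF vs]]) (auto intro!: measurable_component_singleton)
  have \<rho> [measurable]: "?\<rho> \<in> path_space \<rightarrow>\<^sub>M ?N"
  proof -
    have [measurable]: "(\<lambda>f. restrict f (set js)) \<in> PiM UNIV (\<lambda>_. borel) \<rightarrow>\<^sub>M PiM (set js) (\<lambda>_. borel :: real measure)"
      by (rule measurable_restrict_subset) simp
    show ?thesis by measurable
  qed
  have mg: "?mg v \<in> PiM (set rest) (\<lambda>_. borel) \<rightarrow>\<^sub>M PiM (set js) (\<lambda>_. borel)"
    if "v \<in> space (PiM (set vs) (\<lambda>_. borel :: real measure))" for v
    using that measurable_merge[of "set vs" "set rest" "\<lambda>_. borel :: real measure"] unfolding rest(3)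
    by (rule measurable_Pair2[rotated])
  show ?thesis
  proof (rule measure_eqI)
    fix E assume "E \<in> sets (distr (joint_law K vs q) ?N ?\<rho>)"
    then have E [measurable]: "E \<in> sets ?N" by simp
    have E' [measurable]: "?\<rho> -` E \<inter> space path_space \<in> sets path_space"
      using \<rho> E by (rule measurable_sets)
    \<comment> \<open>After projection to \<open>js\<close> only the values at \<open>rest\<close>
      are random, so the finite-dimensional density of \<open>gp_conditional\<close> on
      \<open>rest\<close> determines the kernel.\<close>
    have kernel: "emeasure (?k (x, v)) (?\<rho> -` E \<inter> space path_space) =
        (\<integral>\<^sup>+h. ennreal (gaussian_density rest (cond_mean K vs v) (cond_cov K vs) h) *
          indicator E (x, ?mg v h) \<partial>PiM (set rest) (\<lambda>_. lborel))"
      if v: "v \<in> space (PiM (set vs) (\<lambda>_. borel :: real measure))" for x v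
    proof -
      let ?P = "gp_conditional K vs v"
      have gp: "gaussian_process (- set vs) (cond_mean K vs v) (cond_cov K vs) ?P"
        by (rule gaussian_process_gp_conditional[OF vs])
      then have setsP [measurable_cong]: "sets ?P = sets (PiM (- set vs) (\<lambda>_. borel))"
        by (simp add: gaussian_process_def)
      note [measurable] = mg[OF v]
      let ?E = "{h \<in> space (PiM (set rest) (\<lambda>_. borel)). (x, ?mg v h) \<in> E}"
      have E2: "?E \<in> sets (PiM (set rest) (\<lambda>_. borel))" by measurable
      have r: "(\<lambda>g. restrict g (set rest)) \<in> ?P \<rightarrow>\<^sub>M PiM (set rest) (\<lambda>_. borel)"
        unfolding measurable_cong_sets[OF setsP refl] by (rule measurable_restrict_subset[OF rest(4)])
      have m: "(\<lambda>g. (x, merge (set vs) (- set vs) (v, g))) \<in> ?P \<rightarrow>\<^sub>M path_space"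
        unfolding measurable_cong_sets[OF setsP refl] by (rule measurable_merge_compl)
      have "emeasure (?k (x, v)) (?\<rho> -` E \<inter> space path_space) =
          emeasure ?P ((\<lambda>g. (x, merge (set vs) (- set vs) (v, g))) -` (?\<rho> -` E \<inter> space path_space) \<inter> space ?P)"
        by (simp only: prod.case emeasure_distr[OF m E'])
      also have "(\<lambda>g. (x, merge (set vs) (- set vs) (v, g))) -` (?\<rho> -` E \<inter> space path_space) \<inter> space ?P =
          (\<lambda>g. restrict g (set rest)) -` ?E \<inter> space ?P"
      proof -
        have "restrict (merge (set vs) (- set vs) (v, g)) (set js) = ?mg v (restrict g (set rest))" for g
          using rest by (auto simp: fun_eq_iff merge_def restrict_def)
        then show ?thesis by (auto simp: space_pair_measure space_PiM)
      qed
      also have "emeasure ?P \<dots> = emeasure (distr ?P (PiM (set rest) (\<lambda>_. borel)) (\<lambda>g. restrict g (set rest))) ?E"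
        by (rule emeasure_distr[OF r E2, symmetric])
      also have "distr ?P (PiM (set rest) (\<lambda>_. borel)) (\<lambda>g. restrict g (set rest)) =
          density (PiM (set rest) (\<lambda>_. lborel)) (\<lambda>h. ennreal (gaussian_density rest (cond_mean K vs v) (cond_cov K vs) h))"
        using gp rest unfolding gaussian_process_def by simp
      also have "emeasure \<dots> ?E = (\<integral>\<^sup>+h. ennreal (gaussian_density rest (cond_mean K vs v) (cond_cov K vs) h) *
          indicator ?E h \<partial>PiM (set rest) (\<lambda>_. lborel))"
        using E2 gaussian_density_measurable_PiM[OF pdc]
        by (intro emeasure_density) (simp_all add: sets_PiM_lborel)
      also have "\<dots> = (\<integral>\<^sup>+h. ennreal (gaussian_density rest (cond_mean K vs v) (cond_cov K vs) h) *
          indicator E (x, ?mg v h) \<partial>PiM (set rest) (\<lambda>_. lborel))"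
        by (intro nn_integral_cong) (simp add: indicator_def space_PiM)
      finally show ?thesis .
    qed
    have G: "(\<lambda>w. ennreal (q w) * ennreal (gd_prior js (snd w) / gd_prior vs (snd w)) * indicator E w)
        \<in> borel_measurable ?BJ"
      by measurable
    have kernel_meas: "?k \<in> ?B \<rightarrow>\<^sub>M subprob_algebra path_space"
      by (rule measurable_joint_kernel[OF vs])
    have kE: "(\<lambda>w. emeasure (?k w) (?\<rho> -` E \<inter> space path_space)) \<in> borel_measurable ?B"
      by (rule measurable_compose[OF kernel_meas measurable_emeasure_subprob_algebra[OF E']])
    have qE: "(\<lambda>w. ennreal (q w)) \<in> borel_measurable ?B"
      by (rule measurable_compose[OF qB measurable_ennreal])
    have "emeasure (distr (joint_law K vs q) ?N ?\<rho>) E = emeasure (joint_law K vs q) (?\<rho> -` E \<inter> space path_space)"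
      using E \<rho> sets_eq_imp_space_eq[OF sets_joint_law[OF vs, of q]]
      by (subst emeasure_distr) (simp_all add: measurable_cong_sets[OF sets_joint_law[OF vs] refl])
    also have "\<dots> = (\<integral>\<^sup>+w. emeasure (?k w) (?\<rho> -` E \<inter> space path_space) \<partial>density ?B (\<lambda>w. ennreal (q w)))"
      unfolding joint_law_def
      by (rule emeasure_bind[OF _ _ E']) (use kernel_meas in \<open>simp_all add: space_pair_measure space_PiM PiE_eq_empty_iff\<close>)
    also have "\<dots> = (\<integral>\<^sup>+w. ennreal (q w) * emeasure (?k w) (?\<rho> -` E \<inter> space path_space) \<partial>?B)"
      by (rule nn_integral_density[OF qE kE])
    also have "\<dots> = (\<integral>\<^sup>+x. \<integral>\<^sup>+v. ennreal (q (x, v)) * emeasure (?k (x, v)) (?\<rho> -` E \<inter> space path_space)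
        \<partial>PiM (set vs) (\<lambda>_. lborel) \<partial>lborel)"
      by (rule V.nn_integral_fst[OF borel_measurable_times_ennreal[OF qE kE], symmetric])
    also have "\<dots> = (\<integral>\<^sup>+x. \<integral>\<^sup>+v. \<integral>\<^sup>+h. ennreal (q (x, ?mg v h)) * ennreal (gd_prior js (?mg v h) / gd_prior vs (?mg v h)) *
        indicator E (x, ?mg v h) \<partial>PiM (set rest) (\<lambda>_. lborel) \<partial>PiM (set vs) (\<lambda>_. lborel) \<partial>lborel)"
    proof (intro nn_integral_cong)
      fix x v assume "v \<in> space (PiM (set vs) (\<lambda>_. lborel :: real measure))"
      then have v: "v \<in> space (PiM (set vs) (\<lambda>_. borel :: real measure))" by (simp add: space_PiM_lborel)
      have q_eq: "q (x, ?mg v h) = q (x, v)" for h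
        using is_gaussian_restrict[OF q order_refl, of x "?mg v h"] is_gaussian_restrict[OF q order_refl, of x v]
        by (simp add: merge_def restrict_def cong: if_cong)
      \<comment> \<open>\<open>js\<close> and \<open>vs @ rest\<close> list the same points in
        possibly different order; the chain rule needs the second form.\<close>
      have "gd_prior js (?mg v h) = gd_prior (vs @ rest) (?mg v h)" for h
        using rest js by (intro gaussian_density_permute pd) auto
      moreover have "gd_prior vs (?mg v h) = gd_prior vs v" for h
        by (intro gaussian_density_cong) (simp add: merge_def)
      moreover have "0 < gd_prior vs v" by (rule gaussian_density_pos[OF pd[OF vs]])
      ultimately have gd: "gd_prior js (?mg v h) / gd_prior vs (?mg v h) =
          gaussian_density rest (cond_mean K vs v) (cond_cov K vs) h" for h
        by (simp add: gaussian_density_merge[OF rest(1)])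
      have "(\<lambda>h. ennreal (gaussian_density rest (cond_mean K vs v) (cond_cov K vs) h) * indicator E (x, ?mg v h))
          \<in> borel_measurable (PiM (set rest) (\<lambda>_. lborel))"
        using gaussian_density_measurable_PiM[OF pdc, of "cond_mean K vs v"] mg[OF v] by measurable
      then show "ennreal (q (x, v)) * emeasure (?k (x, v)) (?\<rho> -` E \<inter> space path_space) =
          (\<integral>\<^sup>+h. ennreal (q (x, ?mg v h)) * ennreal (gd_prior js (?mg v h) / gd_prior vs (?mg v h)) *
            indicator E (x, ?mg v h) \<partial>PiM (set rest) (\<lambda>_. lborel))"
        unfolding kernel[OF v] q_eq gd mult.assoc by (rule nn_integral_cmult[symmetric])
    qed
    also have "\<dots> = (\<integral>\<^sup>+x. \<integral>\<^sup>+w. ennreal (q (x, w)) * ennreal (gd_prior js w / gd_prior vs w) * indicator E (x, w)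
        \<partial>PiM (set js) (\<lambda>_. lborel) \<partial>lborel)"
    proof (intro nn_integral_cong)
      fix x
      have "(\<lambda>w. ennreal (q (x, w)) * ennreal (gd_prior js w / gd_prior vs w) * indicator E (x, w))
          \<in> borel_measurable (PiM (set js) (\<lambda>_. lborel))"
        using measurable_compose[OF measurable_Pair1'[of x lborel "PiM (set js) (\<lambda>_. lborel)"] G] by simp
      then show "(\<integral>\<^sup>+v. \<integral>\<^sup>+h. ennreal (q (x, ?mg v h)) * ennreal (gd_prior js (?mg v h) / gd_prior vs (?mg v h)) *
          indicator E (x, ?mg v h) \<partial>PiM (set rest) (\<lambda>_. lborel) \<partial>PiM (set vs) (\<lambda>_. lborel)) =
        (\<integral>\<^sup>+w. ennreal (q (x, w)) * ennreal (gd_prior js w / gd_prior vs w) * indicator E (x, w) \<partial>PiM (set js) (\<lambda>_. lborel))"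
        by (rule product_nn_integral_fold[OF rest(2) finite_set finite_set, unfolded rest(3), symmetric])
    qed
    also have "\<dots> = (\<integral>\<^sup>+w. ennreal (q w) * ennreal (gd_prior js (snd w) / gd_prior vs (snd w)) * indicator E w \<partial>?BJ)"
      using J.nn_integral_fst[OF G] by simp
    also have "\<dots> = emeasure (density ?BJ (\<lambda>w. ennreal (q w) * ennreal (gd_prior js (snd w) / gd_prior vs (snd w)))) E"
      by (rule emeasure_density[symmetric]) (use E in measurable)
    finally show "emeasure (distr (joint_law K vs q) ?N ?\<rho>) E =
      emeasure (density ?BJ (\<lambda>w. ennreal (q w) * ennreal (gd_prior js (snd w) / gd_prior vs (snd w)))) E" .
  qed (simp cong: sets_pair_measure_cong add: sets_PiM_lborel)
qed

end

section \<open>Minimising the inclusive divergence\<close>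

text \<open>A strictly positive real density is the Radon-Nikodym derivative almost everywhere, so
  the entropy density is \<open>ln h\<close>. Absolute continuity is automatic, and only
  integrability can send \<open>KL\<close> to infinity.\<close>

lemma KL_density:
  assumes "prob_space R" and "prob_space (density R (\<lambda>w. ennreal (h w)))"
    and h: "h \<in> borel_measurable R" "\<And>w. 0 < h w"
  shows "KL (density R (\<lambda>w. ennreal (h w))) R =
    (if integrable (density R (\<lambda>w. ennreal (h w))) (\<lambda>w. ln (h w))
     then ereal (\<integral>w. ln (h w) \<partial>density R (\<lambda>w. ennreal (h w))) else \<infinity>)"
proof -
  let ?P = "density R (\<lambda>w. ennreal (h w))"
  interpret R: prob_space R by fact
  have "AE w in R. ennreal (h w) = RN_deriv R ?P w"
    using h by (intro R.RN_deriv_unique) auto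
  then have "AE w in R. entropy_density (exp 1) R ?P w = ln (h w)"
  proof (rule eventually_mono)
    fix w assume eq: "ennreal (h w) = RN_deriv R ?P w"
    have "enn2real (RN_deriv R ?P w) = h w" using h(2)[of w] by (simp flip: eq)
    then show "entropy_density (exp 1) R ?P w = ln (h w)"
      by (simp add: entropy_density_def log_def)
  qed
  then have ae: "AE w in ?P. entropy_density (exp 1) R ?P w = ln (h w)"
    using h by (subst AE_density) auto
  have m: "entropy_density (exp 1) R ?P \<in> borel_measurable ?P" "(\<lambda>w. ln (h w)) \<in> borel_measurable ?P"
    using h measurable_entropy_density[of "exp 1" R ?P] by auto
  have "absolutely_continuous R ?P" using h by (intro absolutely_continuousI_density) auto
  then show ?thesis
    unfolding KL_def KL_divergence_def
    using integrable_cong_AE[OF m ae] integral_cong_AE[OF m ae] by simp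
qed

text \<open>Puts the coordinate to be integrated out last, where the marginalisation lemmas expect
  it.\<close>

lemma is_gaussian_Cons:
  fixes d :: "real ^ 'd"
  assumes "is_gaussian (d # ls) q" "distinct (d # ls)"
  obtains js m S where "distinct (js @ [Inr d])" "set js = range Inl \<union> Inr ` set ls" "pd_on S (js @ [Inr d])"
    "q = (\<lambda>w. gaussian_density (js @ [Inr d]) m S (joint_coord w))"
proof -
  obtain js m S where js: "distinct js" "set js = range Inl \<union> Inr ` set (d # ls)" "pd_on S js"
      and q: "q = (\<lambda>w. gaussian_density js m S (joint_coord w))"
    using assms(1) unfolding is_gaussian_iff by blast
  let ?js = "removeAll (Inr d) js"
  have d: "distinct (?js @ [Inr d])" using js(1) by (simp add: distinct_removeAll)
  have s: "set (?js @ [Inr d]) = set js" using js(2) by auto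
  have "set ?js = range Inl \<union> Inr ` set ls" using js(2) assms(2) by auto
  moreover have "pd_on S (?js @ [Inr d])" by (rule pd_on_set_mono[OF js(3,1) d]) (simp only: s order_refl)
  moreover have "q = (\<lambda>w. gaussian_density (?js @ [Inr d]) m S (joint_coord w))"
    unfolding q using gaussian_density_permute[OF js(3,1) d s] by simp
  ultimately show ?thesis using that d by blast
qed

lemma continuous_gaussian_density_upd:
  assumes "pd_on S js"
  shows "continuous_on UNIV (\<lambda>t. gaussian_density js m S (z(j := t)))"
proof -
  have "continuous_on UNIV (\<lambda>t. (z(j := t)) k)" for k
    by (cases "k = j") (auto intro: continuous_intros)
  then show ?thesis
    unfolding gaussian_density_eq_sum[OF assms] using det_cov_mat_pos[OF assms]
    by (intro continuous_intros) auto
qed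

section \<open>Comparison of the two joint laws\<close>

context gp_prior_state
begin

text \<open>The case of \<open>distr_joint_law\<close> in which the quotient of prior densities is
  one.\<close>

lemma nn_integral_joint_law:
  assumes vs: "distinct vs" and q: "is_gaussian vs q"
    and F: "F \<in> borel_measurable (borel \<Otimes>\<^sub>M PiM (set vs) (\<lambda>_. borel))"
  shows "(\<integral>\<^sup>+(x, f). F (x, restrict f (set vs)) \<partial>joint_law K vs q) =
    (\<integral>\<^sup>+w. ennreal (q w) * F w \<partial>(lborel \<Otimes>\<^sub>M PiM (set vs) (\<lambda>_. lborel)))"
proof -
  let ?B = "lborel \<Otimes>\<^sub>M PiM (set vs) (\<lambda>_. lborel) :: ((real ^ 'd) \<times> (real ^ 'd \<Rightarrow> real)) measure"
  let ?N = "borel \<Otimes>\<^sub>M PiM (set vs) (\<lambda>_. borel) :: ((real ^ 'd) \<times> (real ^ 'd \<Rightarrow> real)) measure"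
  let ?\<rho> = "\<lambda>(x, f). (x :: real ^ 'd, restrict f (set vs) :: real ^ 'd \<Rightarrow> real)"
  have "?\<rho> \<in> path_space \<rightarrow>\<^sub>M ?N"
  proof -
    have [measurable]: "(\<lambda>f. restrict f (set vs)) \<in> PiM UNIV (\<lambda>_. borel) \<rightarrow>\<^sub>M PiM (set vs) (\<lambda>_. borel :: real measure)"
      by (rule measurable_restrict_subset) simp
    show ?thesis by measurable
  qed
  then have \<rho>: "?\<rho> \<in> joint_law K vs q \<rightarrow>\<^sub>M ?N"
    unfolding measurable_cong_sets[OF sets_joint_law[OF vs] refl] .
  have [measurable]: "q \<in> borel_measurable ?N" using is_gaussian_measurable_PiM[OF q order_refl] .
  note [measurable] = F
  have "distr (joint_law K vs q) ?N ?\<rho> = density ?B (\<lambda>w. ennreal (q w))"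
    unfolding distr_joint_law[OF vs vs order_refl q]
    using gaussian_density_pos[OF pd[OF vs]] by (simp add: less_imp_neq[symmetric])
  then have "(\<integral>\<^sup>+w. F (?\<rho> w) \<partial>joint_law K vs q) = (\<integral>\<^sup>+w. F w \<partial>density ?B (\<lambda>w. ennreal (q w)))"
    using nn_integral_distr[OF \<rho>, of F] by simp
  also have "\<dots> = (\<integral>\<^sup>+w. ennreal (q w) * F w \<partial>?B)" by (subst nn_integral_density) auto
  finally show ?thesis by (simp add: split_beta')
qed

lemma prob_space_joint_law:
  assumes vs: "distinct vs" and q: "is_gaussian vs q"
  shows "prob_space (joint_law K vs q)"
proof
  have "emeasure (joint_law K vs q) (space (joint_law K vs q)) = (\<integral>\<^sup>+(x, f). 1 \<partial>joint_law K vs q)"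
    by (simp add: split_beta')
  also have "\<dots> = 1"
    using nn_integral_joint_law[OF vs q, of "\<lambda>_. 1"] nn_integral_is_gaussian[OF q] by simp
  finally show "emeasure (joint_law K vs q) (space (joint_law K vs q)) = 1" .
qed

text \<open>On every finite \<open>J\<close> containing the inducing points both sides have explicit
  densities, and the prior density on \<open>J\<close> is a common factor. The quotient of the rest
  involves only the state and the inducing values, hence is one and the same function for all
  \<open>J\<close>.\<close>

lemma joint_law_Cons_eq_density:
  assumes dist: "distinct (d # ls)" and q: "is_gaussian (d # ls) q" and q': "is_gaussian ls q'"
  shows "joint_law K (d # ls) q = density (joint_law K ls q')
    (\<lambda>w. ennreal (q w * gd_prior ls (snd w) / (q' w * gd_prior (d # ls) (snd w))))"
    (is "?P = density ?R (\<lambda>w. ennreal (?h w))")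
proof -
  have ls: "distinct ls" using dist by simp
  interpret P: prob_space ?P by (rule prob_space_joint_law[OF dist q])
  note setsP = sets_joint_law[OF dist, of q] and setsR = sets_joint_law[OF ls, of q']
  have pos: "0 < q w" "0 < q' w" "0 < gd_prior ls f" "0 < gd_prior (d # ls) f" for w f
    using is_gaussian_pos q q' gaussian_density_pos pd ls dist by blast+
  have hm: "?h \<in> borel_measurable (borel \<Otimes>\<^sub>M PiM J (\<lambda>_. borel))" if "set (d # ls) \<subseteq> J" for J
  proof -
    have [measurable]: "gd_prior vs \<in> borel_measurable (PiM J (\<lambda>_. borel))" if "distinct vs" "set vs \<subseteq> J" for vs
      using that by (intro borel_measurable_gaussian_density[OF pd]) (auto intro!: measurable_component_singleton)
    have [measurable]: "gd_prior ls \<in> borel_measurable (PiM J (\<lambda>_. borel))" "gd_prior (d # ls) \<in> borel_measurable (PiM J (\<lambda>_. borel))"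
      using that ls dist \<open>\<And>vs. distinct vs \<Longrightarrow> set vs \<subseteq> J \<Longrightarrow> gd_prior vs \<in> borel_measurable (PiM J (\<lambda>_. borel))\<close> by auto
    have [measurable]: "q \<in> borel_measurable (borel \<Otimes>\<^sub>M PiM J (\<lambda>_. borel))" "q' \<in> borel_measurable (borel \<Otimes>\<^sub>M PiM J (\<lambda>_. borel))"
      using is_gaussian_measurable_PiM[OF q that] is_gaussian_measurable_PiM[OF q', of J] that by auto
    show ?thesis by measurable
  qed
  have hR: "?h \<in> borel_measurable ?R"
    using hm[OF subset_UNIV] by (simp add: measurable_cong_sets[OF setsR refl])
  have distr_eq: "distr ?P (borel \<Otimes>\<^sub>M PiM J (\<lambda>_. borel)) (\<lambda>(x, f). (x, restrict f J)) =
      distr (density ?R (\<lambda>w. ennreal (?h w))) (borel \<Otimes>\<^sub>M PiM J (\<lambda>_. borel)) (\<lambda>(x, f). (x, restrict f J))"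
    if J: "finite J" "set (d # ls) \<subseteq> J" for J
  proof -
    let ?BJ = "lborel \<Otimes>\<^sub>M PiM J (\<lambda>_. lborel) :: ((real ^ 'd) \<times> (real ^ 'd \<Rightarrow> real)) measure"
    let ?N = "borel \<Otimes>\<^sub>M PiM J (\<lambda>_. borel) :: ((real ^ 'd) \<times> (real ^ 'd \<Rightarrow> real)) measure"
    let ?\<rho> = "\<lambda>(x, f). (x :: real ^ 'd, restrict f J :: real ^ 'd \<Rightarrow> real)"
    have setsBJ: "sets ?BJ = sets ?N" by (intro sets_pair_measure_cong) (simp_all add: sets_PiM_lborel)
    obtain js where js: "distinct js" "set js = J" using finite_distinct_list[OF J(1)] by blast
    have "?\<rho> \<in> path_space \<rightarrow>\<^sub>M ?N"
    proof -
      have [measurable]: "(\<lambda>f. restrict f J) \<in> PiM UNIV (\<lambda>_. borel) \<rightarrow>\<^sub>M PiM J (\<lambda>_. borel :: real measure)"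
        by (rule measurable_restrict_subset) simp
      show ?thesis by measurable
    qed
    then have \<rho>: "?\<rho> \<in> ?R \<rightarrow>\<^sub>M ?N"
      unfolding measurable_cong_sets[OF setsR refl] .
    \<comment> \<open>Since \<open>?h\<close> factors through the projection to \<open>J\<close>,
      weighting by it commutes with that projection.\<close>
    have h\<rho>: "?h (?\<rho> w) = ?h w" for w
    proof -
      obtain x f where w: "w = (x, f)" by (cases w)
      have "gd_prior vs (restrict f J) = gd_prior vs f" if "set vs \<subseteq> J" for vs
        using that by (intro gaussian_density_cong) auto
      then have "gd_prior ls (restrict f J) = gd_prior ls f" "gd_prior (d # ls) (restrict f J) = gd_prior (d # ls) f"
        using J by auto
      then show ?thesis
        using is_gaussian_restrict[OF q J(2)] is_gaussian_restrict[OF q', of J x f] J(2) by (simp add: w)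
    qed
    have qm: "q' \<in> borel_measurable ?BJ" "(\<lambda>w. gd_prior js (snd w) / gd_prior ls (snd w)) \<in> borel_measurable ?BJ" "?h \<in> borel_measurable ?BJ"
    proof -
      show "q' \<in> borel_measurable ?BJ" "?h \<in> borel_measurable ?BJ"
        unfolding measurable_cong_sets[OF setsBJ refl]
        using is_gaussian_measurable_PiM[OF q', of J] J hm[OF J(2)] by auto
      have [measurable]: "gd_prior js \<in> borel_measurable (PiM J (\<lambda>_. borel))"
        using js by (intro borel_measurable_gaussian_density[OF pd]) (auto intro!: measurable_component_singleton)
      have [measurable]: "gd_prior ls \<in> borel_measurable (PiM J (\<lambda>_. borel))"
        using ls J by (intro borel_measurable_gaussian_density[OF pd]) (auto intro!: measurable_component_singleton)
      show "(\<lambda>w. gd_prior js (snd w) / gd_prior ls (snd w)) \<in> borel_measurable ?BJ"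
        unfolding measurable_cong_sets[OF setsBJ refl] by measurable
    qed
    have "distr (density ?R (\<lambda>w. ennreal (?h w))) ?N ?\<rho> = density (distr ?R ?N ?\<rho>) (\<lambda>w. ennreal (?h w))"
      using density_distr[of "\<lambda>w. ennreal (?h w)" ?N ?\<rho> ?R] hm[OF J(2)] \<rho> by (simp only: h\<rho>) simp
    also have "distr ?R ?N ?\<rho> = density ?BJ (\<lambda>w. ennreal (q' w) * ennreal (gd_prior js (snd w) / gd_prior ls (snd w)))"
      using distr_joint_law[OF ls js(1) _ q'] J(2) js(2) by simp
    also have "density \<dots> (\<lambda>w. ennreal (?h w)) =
        density ?BJ (\<lambda>w. ennreal (q' w) * ennreal (gd_prior js (snd w) / gd_prior ls (snd w)) * ennreal (?h w))"
      using qm by (intro density_density_eq) auto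
    also have "\<dots> = density ?BJ (\<lambda>w. ennreal (q w) * ennreal (gd_prior js (snd w) / gd_prior (d # ls) (snd w)))"
    proof (intro arg_cong2[where f = density] refl ext)
      fix w :: "(real ^ 'd) \<times> (real ^ 'd \<Rightarrow> real)"
      have "0 < gd_prior js (snd w)" by (rule gaussian_density_pos[OF pd[OF js(1)]])
      then show "ennreal (q' w) * ennreal (gd_prior js (snd w) / gd_prior ls (snd w)) * ennreal (?h w) =
          ennreal (q w) * ennreal (gd_prior js (snd w) / gd_prior (d # ls) (snd w))"
        using pos by (simp add: ennreal_mult[symmetric] less_imp_le) (simp add: less_imp_neq[symmetric] field_simps)
    qed
    also have "\<dots> = distr ?P ?N ?\<rho>"
      using distr_joint_law[OF dist js(1) _ q] J(2) js(2) by simp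
    finally show ?thesis by (rule sym)
  qed
  show ?thesis
  proof (rule joint_measure_eqI[where V = "set (d # ls)", OF setsP _ P.finite_measure _ _ distr_eq])
    show "sets (density ?R (\<lambda>w. ennreal (?h w))) = sets path_space" using setsR by simp
    let ?\<rho> = "\<lambda>(x, f). (x :: real ^ 'd, restrict f (set (d # ls)) :: real ^ 'd \<Rightarrow> real)"
    let ?N = "borel \<Otimes>\<^sub>M PiM (set (d # ls)) (\<lambda>_. borel) :: ((real ^ 'd) \<times> (real ^ 'd \<Rightarrow> real)) measure"
    have "?\<rho> \<in> path_space \<rightarrow>\<^sub>M ?N"
    proof -
      have [measurable]: "(\<lambda>f. restrict f (set (d # ls))) \<in> PiM UNIV (\<lambda>_. borel) \<rightarrow>\<^sub>M PiM (set (d # ls)) (\<lambda>_. borel :: real measure)"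
        by (rule measurable_restrict_subset) simp
      show ?thesis by measurable
    qed
    then have \<rho>: "?\<rho> \<in> density ?R (\<lambda>w. ennreal (?h w)) \<rightarrow>\<^sub>M ?N" "?\<rho> \<in> ?P \<rightarrow>\<^sub>M ?N"
      by (simp_all only: measurable_density_eq1 measurable_cong_sets[OF setsR refl] measurable_cong_sets[OF setsP refl])
    \<comment> \<open>Nothing yet says that the right-hand side has finite mass. Its projection
      equals that of \<open>?P\<close>, and a projection preserves total mass.\<close>
    have "prob_space (distr (density ?R (\<lambda>w. ennreal (?h w))) ?N ?\<rho>)"
      using distr_eq[of "set (d # ls)"] P.prob_space_distr[OF \<rho>(2)] by simp
    then have "prob_space (density ?R (\<lambda>w. ennreal (?h w)))"
      by (rule prob_space_distrD[OF \<rho>(1)])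
    then show "finite_measure (density ?R (\<lambda>w. ennreal (?h w)))" by (rule prob_space.finite_measure)
  qed auto
qed

lemma integrable_joint_coord_square:
  assumes vs: "distinct vs" and q: "is_gaussian vs q" and j: "j \<in> range Inl \<union> Inr ` set vs"
  shows "(\<lambda>w. joint_coord w j) \<in> borel_measurable (joint_law K vs q)"
    and "integrable (joint_law K vs q) (\<lambda>w. (joint_coord w j)\<^sup>2)"
proof -
  interpret P: prob_space "joint_law K vs q" by (rule prob_space_joint_law[OF vs q])
  obtain js m S where js: "distinct js" "set js = range Inl \<union> Inr ` set vs" "pd_on S js"
      and qd: "q = (\<lambda>w. gaussian_density js m S (joint_coord w))"
    using q unfolding is_gaussian_iff by blast
  have [measurable]: "(\<lambda>x :: real ^ 'd. vec_nth x i) \<in> borel_measurable borel" for i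
    by (intro borel_measurable_continuous_onI continuous_intros)
  have coord: "(\<lambda>w :: (real ^ 'd) \<times> (real ^ 'd \<Rightarrow> real). joint_coord w j) \<in> borel_measurable (borel \<Otimes>\<^sub>M PiM J (\<lambda>_. borel))" if "set vs \<subseteq> J" for J
  proof -
    from j that consider i where "j = Inl i" | s where "j = Inr s" "s \<in> J" by auto
    then show ?thesis by cases (simp_all add: joint_coord_def split_beta')
  qed
  show meas [measurable]: "(\<lambda>w. joint_coord w j) \<in> borel_measurable (joint_law K vs q)"
    unfolding measurable_cong_sets[OF sets_joint_law[OF vs] refl] by (rule coord) simp
  let ?J = "range Inl \<union> Inr ` set vs :: ('d + real ^ 'd) set"
  let ?F = "\<lambda>w :: (real ^ 'd) \<times> (real ^ 'd \<Rightarrow> real). ennreal ((joint_coord w j - m j)\<^sup>2)"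
  have "(\<integral>\<^sup>+w. ?F w \<partial>joint_law K vs q) = (\<integral>\<^sup>+(x, f). ?F (x, restrict f (set vs)) \<partial>joint_law K vs q)"
    using j by (intro nn_integral_cong) (auto simp: joint_coord_def)
  also have "\<dots> = (\<integral>\<^sup>+w. ennreal (q w) * ?F w \<partial>(lborel \<Otimes>\<^sub>M PiM (set vs) (\<lambda>_. lborel)))"
    by (intro nn_integral_joint_law[OF vs q] measurable_compose[OF _ measurable_ennreal]
        borel_measurable_power borel_measurable_diff coord[OF order_refl] borel_measurable_const)
  also have "\<dots> = (\<integral>\<^sup>+w. (\<lambda>z. ennreal ((z j - m j)\<^sup>2) * ennreal (gaussian_density js m S z))
      (restrict (joint_coord w) ?J) \<partial>(lborel \<Otimes>\<^sub>M PiM (set vs) (\<lambda>_. lborel)))"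
  proof (intro nn_integral_cong)
    fix w :: "(real ^ 'd) \<times> (real ^ 'd \<Rightarrow> real)"
    have "q w = gaussian_density js m S (restrict (joint_coord w) ?J)"
      unfolding qd js(2)[symmetric] by (intro gaussian_density_cong) simp
    then show "ennreal (q w) * ?F w = (\<lambda>z. ennreal ((z j - m j)\<^sup>2) * ennreal (gaussian_density js m S z))
      (restrict (joint_coord w) ?J)" using j by (simp add: mult.commute)
  qed
  also have "\<dots> = (\<integral>\<^sup>+z. ennreal ((z j - m j)\<^sup>2) * ennreal (gaussian_density js m S z) \<partial>PiM ?J (\<lambda>_. lborel))"
    using gaussian_density_measurable_PiM[OF js(3), of m] j
    by (intro nn_integral_joint_coord) (simp_all add: js(2))
  also have "\<dots> < \<infinity>"
    using nn_integral_gaussian_density_square[OF js(3,1), of j m] j unfolding js(2) by simp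
  finally have "integrable (joint_law K vs q) (\<lambda>w. (joint_coord w j - m j)\<^sup>2)"
    by (intro integrableI_nonneg) auto
  then have int: "integrable (joint_law K vs q) (\<lambda>w. 2 * (joint_coord w j - m j)\<^sup>2 + 2 * (m j)\<^sup>2)"
    by simp
  show "integrable (joint_law K vs q) (\<lambda>w. (joint_coord w j)\<^sup>2)"
  proof (rule Bochner_Integration.integrable_bound[OF int])
    show "AE w in joint_law K vs q. norm ((joint_coord w j)\<^sup>2) \<le> norm (2 * (joint_coord w j - m j)\<^sup>2 + 2 * (m j)\<^sup>2)"
    proof (intro AE_I2)
      fix w :: "(real ^ 'd) \<times> (real ^ 'd \<Rightarrow> real)"
      \<comment> \<open>This square is exactly the slack in the bound that follows, which passes
        from the moment about \<open>m j\<close> to the one about zero.\<close>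
      have "0 \<le> (joint_coord w j - 2 * m j)\<^sup>2" by simp
      then have "(joint_coord w j)\<^sup>2 \<le> 2 * (joint_coord w j - m j)\<^sup>2 + 2 * (m j)\<^sup>2"
        by (simp add: power2_eq_square algebra_simps)
      then show "norm ((joint_coord w j)\<^sup>2) \<le> norm (2 * (joint_coord w j - m j)\<^sup>2 + 2 * (m j)\<^sup>2)" by simp
    qed
  qed measurable
qed

lemma integrable_ln_is_gaussian:
  assumes "distinct vs" "is_gaussian vs q" "is_gaussian us q'" "set us \<subseteq> set vs"
  shows "integrable (joint_law K vs q) (\<lambda>w. ln (q' w))"
proof -
  interpret P: prob_space "joint_law K vs q" by (rule prob_space_joint_law[OF assms(1,2)])
  obtain js m S where js: "set js = range Inl \<union> Inr ` set us" "pd_on S js"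
      and q': "q' = (\<lambda>w. gaussian_density js m S (joint_coord w))"
    using assms(3) unfolding is_gaussian_iff by blast
  show ?thesis unfolding q'
    using js assms(4) by (intro P.integrable_ln_gaussian_density integrable_joint_coord_square assms(1,2)) auto
qed

lemma integrable_ln_gd_prior:
  assumes "distinct vs" "is_gaussian vs q" "distinct us" "set us \<subseteq> set vs"
  shows "integrable (joint_law K vs q) (\<lambda>w. ln (gd_prior us (snd w)))"
proof -
  interpret P: prob_space "joint_law K vs q" by (rule prob_space_joint_law[OF assms(1,2)])
  have eq: "snd w s = joint_coord w (Inr s)" for w :: "(real ^ 'd) \<times> (real ^ 'd \<Rightarrow> real)" and s
    by (simp add: joint_coord_def split_beta')
  show ?thesis
  proof (rule P.integrable_ln_gaussian_density[OF pd[OF assms(3)]])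
    fix s assume "s \<in> set us"
    then have "Inr s \<in> range Inl \<union> Inr ` set vs" using assms(4) by auto
    from integrable_joint_coord_square[OF assms(1,2) this]
    show "(\<lambda>w. snd w s) \<in> borel_measurable (joint_law K vs q)" "integrable (joint_law K vs q) (\<lambda>w. (snd w s)\<^sup>2)"
      by (simp_all add: eq)
  qed
qed

text \<open>\<open>C\<close> is obtained before \<open>q'\<close>: it is the mean of the part
  \<open>?g\<close> of the log-density ratio that is free of \<open>q'\<close>. Both parts are
  integrable, so comparing divergences is comparing real numbers.\<close>

lemma KL_joint_law_Cons:
  assumes dist: "distinct (d # ls)" and q: "is_gaussian (d # ls) q"
  obtains C where "\<And>q'. is_gaussian ls q' \<Longrightarrow>
    KL (joint_law K (d # ls) q) (joint_law K ls q') = ereal (C - (\<integral>w. ln (q' w) \<partial>joint_law K (d # ls) q))"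
proof -
  have ls: "distinct ls" using dist by simp
  have sub: "set ls \<subseteq> set (d # ls)" by auto
  let ?P = "joint_law K (d # ls) q"
  let ?g = "\<lambda>w. ln (q w) + ln (gd_prior ls (snd w)) - ln (gd_prior (d # ls) (snd w))"
  have int: "integrable ?P ?g"
    using dist ls q by (intro Bochner_Integration.integrable_add Bochner_Integration.integrable_diff
        integrable_ln_is_gaussian integrable_ln_gd_prior) auto
  have "KL ?P (joint_law K ls q') = ereal ((\<integral>w. ?g w \<partial>?P) - (\<integral>w. ln (q' w) \<partial>?P))" if q': "is_gaussian ls q'" for q'
  proof -
    let ?R = "joint_law K ls q'"
    let ?h = "\<lambda>w. q w * gd_prior ls (snd w) / (q' w * gd_prior (d # ls) (snd w))"
    have P: "?P = density ?R (\<lambda>w. ennreal (?h w))" by (rule joint_law_Cons_eq_density[OF dist q q'])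
    have pos: "0 < q w" "0 < q' w" "0 < gd_prior ls f" "0 < gd_prior (d # ls) f" for w f
      using is_gaussian_pos q q' gaussian_density_pos pd ls dist by blast+
    have hpos: "0 < ?h w" for w using pos by simp
    have meas: "?h \<in> borel_measurable ?R"
    proof -
      have [measurable]: "q \<in> borel_measurable path_space" "q' \<in> borel_measurable path_space"
        using is_gaussian_measurable_PiM[OF q subset_UNIV] is_gaussian_measurable_PiM[OF q' subset_UNIV] .
      have [measurable]: "gd_prior vs \<in> borel_measurable (PiM UNIV (\<lambda>_. borel))" if "distinct vs" for vs
        by (intro borel_measurable_gaussian_density[OF pd[OF that]]) simp
      show ?thesis
        unfolding measurable_cong_sets[OF sets_joint_law[OF ls] refl] using ls dist by measurable
    qed
    have "ln (?h w) = ?g w - ln (q' w)" for w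
      using pos by (simp add: ln_div ln_mult pos[THEN less_imp_neq, symmetric])
    moreover have "integrable ?P (\<lambda>w. ?g w - ln (q' w))"
      using int integrable_ln_is_gaussian[OF dist q q' sub] by (rule Bochner_Integration.integrable_diff)
    moreover have "KL ?P ?R = (if integrable ?P (\<lambda>w. ln (?h w)) then ereal (\<integral>w. ln (?h w) \<partial>?P) else \<infinity>)"
      using KL_density[OF prob_space_joint_law[OF ls q'] _ meas hpos] prob_space_joint_law[OF dist q]
      unfolding P[symmetric] by simp
    ultimately show ?thesis
      using Bochner_Integration.integral_diff[OF int integrable_ln_is_gaussian[OF dist q q' sub]] by auto
  qed
  then show ?thesis using that by blast
qed

text \<open>Gibbs' inequality from \<open>ln u \<le> u - 1\<close> for a ratio \<open>u\<close> of
  mean one. Equality forces \<open>u = 1\<close> almost everywhere, and separate continuity then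
  gives equality everywhere.\<close>

lemma gibbs_is_gaussian:
  assumes dist: "distinct (d # ls)"
    and js: "distinct (js @ [Inr d])" "set js = range Inl \<union> Inr ` set ls" "pd_on S (js @ [Inr d])"
    and qd: "q = (\<lambda>w. gaussian_density (js @ [Inr d]) m S (joint_coord w))"
    and q': "is_gaussian ls q'"
  defines "qm \<equiv> (\<lambda>w. gaussian_density js m S (joint_coord w))"
  shows "(\<integral>w. ln (q' w) \<partial>joint_law K (d # ls) q) \<le> (\<integral>w. ln (qm w) \<partial>joint_law K (d # ls) q)"
    and "(\<integral>w. ln (q' w) \<partial>joint_law K (d # ls) q) = (\<integral>w. ln (qm w) \<partial>joint_law K (d # ls) q) \<Longrightarrow> q' = qm"
proof -
  let ?P = "joint_law K (d # ls) q"
  let ?J = "range Inl \<union> Inr ` set (d # ls) :: ('d + real ^ 'd) set"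
  let ?B = "lborel \<Otimes>\<^sub>M PiM (set (d # ls)) (\<lambda>_. lborel) :: ((real ^ 'd) \<times> (real ^ 'd \<Rightarrow> real)) measure"
  let ?N = "borel \<Otimes>\<^sub>M PiM (set (d # ls)) (\<lambda>_. borel) :: ((real ^ 'd) \<times> (real ^ 'd \<Rightarrow> real)) measure"
  have setsB: "sets ?B = sets ?N" by (intro sets_pair_measure_cong) (simp_all add: sets_PiM_lborel)
  have J: "set (js @ [Inr d]) = ?J" "insert (Inr d) (set js) = ?J" using js(2) by auto
  have pdj: "pd_on S js" by (rule pd_on_appendD1[OF js(3)])
  have q: "is_gaussian (d # ls) q" unfolding is_gaussian_iff using js J qd by blast
  have qm: "is_gaussian ls qm" unfolding is_gaussian_iff qm_def using js pdj by auto
  obtain js' m' S' where js': "distinct js'" "set js' = set js" "pd_on S' js'"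
      and q'd: "q' = (\<lambda>w. gaussian_density js' m' S' (joint_coord w))"
    using q' unfolding is_gaussian_iff js(2) by blast
  interpret P: prob_space ?P by (rule prob_space_joint_law[OF dist q])
  interpret product_sigma_finite "\<lambda>_::'d + real ^ 'd. lborel :: real measure" by (rule product_sigma_finite_lborel)
  note setsP = sets_joint_law[OF dist, of q]
  have sub: "set ls \<subseteq> set (d # ls)" by auto
  have pos: "0 < q w" "0 < q' w" "0 < qm w" for w
    using is_gaussian_pos q q' qm by blast+
  have measP: "q' \<in> borel_measurable ?P" "qm \<in> borel_measurable ?P"
    unfolding measurable_cong_sets[OF setsP refl]
    using is_gaussian_measurable_PiM[OF q' subset_UNIV] is_gaussian_measurable_PiM[OF qm subset_UNIV] by auto
  have measN: "q' \<in> borel_measurable ?N" "qm \<in> borel_measurable ?N"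
    using is_gaussian_measurable_PiM[OF q' sub] is_gaussian_measurable_PiM[OF qm sub] by auto
  define u where "u w = q' w / qm w" for w
  have upos: "0 < u w" for w using pos by (simp add: u_def)
  have uP: "u \<in> borel_measurable ?P" unfolding u_def using measP by measurable
  have uN: "u \<in> borel_measurable ?N" unfolding u_def using measN by measurable
  have qJ: "q w = gaussian_density (js @ [Inr d]) m S (restrict (joint_coord w) ?J)" for w
    unfolding qd J(1)[symmetric] by (intro gaussian_density_cong) simp
  have qmJ: "qm w = gaussian_density js m S (restrict (joint_coord w) ?J)" for w
    unfolding qm_def J(2)[symmetric] by (intro gaussian_density_cong) simp
  have q'J: "q' w = gaussian_density js' m' S' (restrict (joint_coord w) ?J)" for w
    unfolding q'd J(2)[symmetric] by (intro gaussian_density_cong) (simp add: js'(2))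
  let ?r = "\<lambda>z. gaussian_density js' m' S' z / gaussian_density js m S z"
  have gJ [measurable]: "gaussian_density (js @ [Inr d]) m S \<in> borel_measurable (PiM ?J (\<lambda>_. lborel))"
    "gaussian_density js m S \<in> borel_measurable (PiM ?J (\<lambda>_. lborel))"
    "gaussian_density js' m' S' \<in> borel_measurable (PiM ?J (\<lambda>_. lborel))"
  proof -
    have "(\<lambda>z. z j) \<in> borel_measurable (PiM ?J (\<lambda>_. lborel))" if "j \<in> ?J" for j
      using measurable_component_singleton[OF that, of "\<lambda>_. lborel"] by simp
    then show "gaussian_density (js @ [Inr d]) m S \<in> borel_measurable (PiM ?J (\<lambda>_. lborel))"
      "gaussian_density js m S \<in> borel_measurable (PiM ?J (\<lambda>_. lborel))"
      "gaussian_density js' m' S' \<in> borel_measurable (PiM ?J (\<lambda>_. lborel))"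
      unfolding J(2)[symmetric]
      by (intro borel_measurable_gaussian_density js(3) pdj js'(3) borel_measurable_diff borel_measurable_const;
          auto simp: js'(2))+
  qed
  \<comment> \<open>Integrating out the discarded coordinate turns \<open>q\<close> into
    \<open>qm\<close>, which cancels the denominator of \<open>u\<close>; \<open>q'\<close> has
    total mass one.\<close>
  have u_int: "(\<integral>\<^sup>+w. ennreal (u w) \<partial>?P) = 1"
  proof -
    have "u (x, restrict f (set (d # ls))) = u (x, f)" for x f
      unfolding u_def using is_gaussian_restrict[OF q' sub] is_gaussian_restrict[OF qm sub] by simp
    then have "(\<integral>\<^sup>+w. ennreal (u w) \<partial>?P) = (\<integral>\<^sup>+(x, f). ennreal (u (x, restrict f (set (d # ls)))) \<partial>?P)"
      by (simp only: split_beta' prod.collapse)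
    also have "\<dots> = (\<integral>\<^sup>+w. ennreal (q w) * ennreal (u w) \<partial>?B)"
      by (rule nn_integral_joint_law[OF dist q measurable_compose[OF uN measurable_ennreal]])
    also have "\<dots> = (\<integral>\<^sup>+w. (\<lambda>z. ennreal (gaussian_density (js @ [Inr d]) m S z) * ennreal (?r z))
        (restrict (joint_coord w) ?J) \<partial>?B)"
      by (simp only: u_def qJ qmJ q'J)
    also have "\<dots> = (\<integral>\<^sup>+z. ennreal (gaussian_density (js @ [Inr d]) m S z) * ennreal (?r z) \<partial>PiM ?J (\<lambda>_. lborel))"
      by (rule nn_integral_joint_coord) (simp, measurable)
    also have "\<dots> = (\<integral>\<^sup>+x. \<integral>\<^sup>+t. ennreal (gaussian_density (js @ [Inr d]) m S (x(Inr d := t))) * ennreal (?r (x(Inr d := t)))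
        \<partial>lborel \<partial>PiM (set js) (\<lambda>_. lborel))"
    proof -
      have "(\<lambda>z. ennreal (gaussian_density (js @ [Inr d]) m S z) * ennreal (?r z)) \<in>
          borel_measurable (PiM (insert (Inr d) (set js)) (\<lambda>_. lborel))"
        unfolding J(2) by measurable
      then show ?thesis
        unfolding J(2)[symmetric] using js(1) by (intro product_nn_integral_insert) auto
    qed
    also have "\<dots> = (\<integral>\<^sup>+x. ennreal (gaussian_density js' m' S' x) \<partial>PiM (set js) (\<lambda>_. lborel))"
    proof (intro nn_integral_cong)
      fix x :: "'d + real ^ 'd \<Rightarrow> real" assume x: "x \<in> space (PiM (set js) (\<lambda>_. lborel :: real measure))"
      \<comment> \<open>Both densities in the ratio ignore the discarded coordinate, so it leaves
        the inner integral as a constant.\<close>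
      have "?r (x(Inr d := t)) = ?r x" for t
        using js(1) js'(2) by (intro arg_cong2[where f = "(/)"] gaussian_density_cong) auto
      moreover have "(\<lambda>t. ennreal (gaussian_density (js @ [Inr d]) m S (x(Inr d := t)))) \<in> borel_measurable lborel"
      proof -
        have "(\<lambda>t. (x(Inr d := t)) k) \<in> borel_measurable lborel" for k
          by (cases "k = Inr d") auto
        then show ?thesis
          by (intro measurable_compose[OF _ measurable_ennreal] borel_measurable_gaussian_density[OF js(3)] borel_measurable_diff) auto
      qed
      moreover have "0 < gaussian_density js m S x" "0 < gaussian_density js' m' S' x"
        using gaussian_density_pos pdj js'(3) by blast+
      ultimately show "(\<integral>\<^sup>+t. ennreal (gaussian_density (js @ [Inr d]) m S (x(Inr d := t))) * ennreal (?r (x(Inr d := t))) \<partial>lborel) =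
          ennreal (gaussian_density js' m' S' x)"
        using nn_integral_gaussian_density_snoc[OF js(3), of m x] js(1)
        by (simp add: nn_integral_multc ennreal_mult[symmetric] less_imp_le)
    qed
    also have "\<dots> = 1"
      using nn_integral_gaussian_density[OF js'(3,1)] unfolding js'(2) .
    finally show ?thesis .
  qed
  have u: "integrable ?P u"
    using uP u_int upos by (intro integrableI_nonneg) (auto simp: less_imp_le)
  have u1: "(\<integral>w. u w \<partial>?P) = 1"
    using nn_integral_eq_integral[OF u] u_int upos by (simp add: less_imp_le)
  have i': "integrable ?P (\<lambda>w. ln (q' w))" and im: "integrable ?P (\<lambda>w. ln (qm w))"
    using integrable_ln_is_gaussian[OF dist q q' sub] integrable_ln_is_gaussian[OF dist q qm sub] .
  \<comment> \<open>The slack in \<open>ln u \<le> u - 1\<close>. As \<open>u\<close> has mean one,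
    its integral is the difference between the two sides of the claim.\<close>
  let ?g = "\<lambda>w. u w - 1 - (ln (q' w) - ln (qm w))"
  have ln_u: "ln (q' w) - ln (qm w) = ln (u w)" for w using pos by (simp add: u_def ln_div pos[THEN less_imp_neq, symmetric])
  have g_nonneg: "0 \<le> ?g w" for w
    unfolding ln_u using ln_le_minus_one[OF upos[of w]] by simp
  have g: "integrable ?P ?g" using u i' im by auto
  have g_int: "(\<integral>w. ?g w \<partial>?P) = (\<integral>w. ln (qm w) \<partial>?P) - (\<integral>w. ln (q' w) \<partial>?P)"
    using u i' im u1 by (simp add: P.prob_space)
  have "0 \<le> (\<integral>w. ?g w \<partial>?P)" using g_nonneg by simp
  then show "(\<integral>w. ln (q' w) \<partial>?P) \<le> (\<integral>w. ln (qm w) \<partial>?P)" unfolding g_int by simp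
  assume eq: "(\<integral>w. ln (q' w) \<partial>?P) = (\<integral>w. ln (qm w) \<partial>?P)"
  then have "AE w in ?P. ?g w = 0"
    using integral_nonneg_eq_0_iff_AE[OF g] g_nonneg g_int by simp
  then have ae: "AE w in ?P. u w = 1"
  proof (rule eventually_mono)
    fix w assume "?g w = 0"
    then show "u w = 1" unfolding ln_u by (intro ln_eq_minus_one[OF upos]) simp
  qed
  let ?G = "\<lambda>z. gaussian_density js' m' S' z - gaussian_density js m S z"
  have G: "?G \<in> borel_measurable (PiM ?J (\<lambda>_. lborel))" by measurable
  have "(\<integral>\<^sup>+(x, f). ennreal \<bar>u (x, restrict f (set (d # ls))) - 1\<bar> \<partial>?P) = (\<integral>\<^sup>+w. ennreal \<bar>u w - 1\<bar> \<partial>?P)"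
  proof -
    have "u (x, restrict f (set (d # ls))) = u (x, f)" for x f
      unfolding u_def using is_gaussian_restrict[OF q' sub] is_gaussian_restrict[OF qm sub] by simp
    then show ?thesis by (simp only: split_beta' prod.collapse)
  qed
  also have "\<dots> = 0"
    using ae uP by (subst nn_integral_0_iff_AE) auto
  finally have "(\<integral>\<^sup>+w. ennreal (q w) * ennreal \<bar>u w - 1\<bar> \<partial>?B) = 0"
    using nn_integral_joint_law[OF dist q, of "\<lambda>w. ennreal \<bar>u w - 1\<bar>"] uN by simp
  also have "(\<integral>\<^sup>+w. ennreal (q w) * ennreal \<bar>u w - 1\<bar> \<partial>?B) =
      (\<integral>\<^sup>+w. (\<lambda>z. ennreal (gaussian_density (js @ [Inr d]) m S z) * ennreal \<bar>?r z - 1\<bar>)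
        (restrict (joint_coord w) ?J) \<partial>?B)"
    by (simp only: u_def qJ qmJ q'J)
  also have "\<dots> = (\<integral>\<^sup>+z. ennreal (gaussian_density (js @ [Inr d]) m S z) * ennreal \<bar>?r z - 1\<bar> \<partial>PiM ?J (\<lambda>_. lborel))"
    by (rule nn_integral_joint_coord) (simp, measurable)
  finally have "AE z in PiM ?J (\<lambda>_. lborel). ennreal (gaussian_density (js @ [Inr d]) m S z) * ennreal \<bar>?r z - 1\<bar> = 0"
    by (subst (asm) nn_integral_0_iff_AE) measurable
  \<comment> \<open>Positivity of the weight \<open>q\<close> turns a null set of the law into a
    Lebesgue null set. The ratio is replaced by a difference, whose separate continuity is
    immediate.\<close>
  then have "AE z in PiM ?J (\<lambda>_. lborel). ?G z = 0"
  proof (rule eventually_mono)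
    fix z assume "ennreal (gaussian_density (js @ [Inr d]) m S z) * ennreal \<bar>?r z - 1\<bar> = 0"
    moreover have "0 < gaussian_density (js @ [Inr d]) m S z" "0 < gaussian_density js m S z"
      using gaussian_density_pos js(3) pdj by blast+
    ultimately show "?G z = 0" by (auto simp: ennreal_eq_0_iff)
  qed
  then have zero: "\<forall>z\<in>space (PiM ?J (\<lambda>_. lborel :: real measure)). ?G z = 0"
    by (intro separately_continuous_AE_PiM_zero[OF _ G] continuous_on_diff continuous_gaussian_density_upd pdj js'(3)) auto
  show "q' = qm"
  proof
    fix w
    \<comment> \<open>\<open>q'\<close> and \<open>qm\<close> see only coordinates in
      \<open>?J\<close>, so agreement on the product space is agreement at every pair of a state and
      a full function.\<close>
    have "restrict (joint_coord w) ?J \<in> space (PiM ?J (\<lambda>_. lborel :: real measure))" by (simp add: space_PiM)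
    then show "q' w = qm w" unfolding q'J qmJ using zero by fastforce
  qed
qed

end

text \<open>Equality of the set of minimisers with a singleton expresses existence and uniqueness at
  once, including that the marginal is itself Gaussian.\<close>

theorem mainTheorem2:
  fixes K :: "real ^ 'd \<Rightarrow> real ^ 'd \<Rightarrow> real"
    and prior :: "(real ^ 'd \<Rightarrow> real) measure"
    and d :: "real ^ 'd" and ls :: "(real ^ 'd) list"
    and q :: "(real ^ 'd) \<times> (real ^ 'd \<Rightarrow> real) \<Rightarrow> real"
  assumes "covariance_kernel K"
    and "\<And>xs. distinct xs \<Longrightarrow> invertible_mat (cov_mat K xs xs)"
    and "gaussian_process UNIV (\<lambda>_. 0) K prior"
    and "distinct (d # ls)"
    and "is_gaussian (d # ls) q"
  shows "{q'. is_arg_min (\<lambda>q'. KL (joint_law K (d # ls) q) (joint_law K ls q')) (is_gaussian ls) q'}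
         = {\<lambda>(x, v). LINT t|lborel. q (x, v(d := t))}"
proof -
  interpret gp_prior_state K prior
    using assms(1-3) by unfold_locales (auto intro: pd_onI simp: covariance_kernel_def)
  obtain js m S where js: "distinct (js @ [Inr d])" "set js = range Inl \<union> Inr ` set ls" "pd_on S (js @ [Inr d])"
      and q: "q = (\<lambda>w. gaussian_density (js @ [Inr d]) m S (joint_coord w))"
    using is_gaussian_Cons[OF assms(5,4)] .
  define qm where "qm = (\<lambda>w :: (real ^ 'd) \<times> (real ^ 'd \<Rightarrow> real). gaussian_density js m S (joint_coord w))"
  have qm: "is_gaussian ls qm"
    unfolding is_gaussian_iff qm_def using js pd_on_appendD1[OF js(3)] by auto
  \<comment> \<open>Updating the function at \<open>d\<close> is updating the joint coordinate
    \<open>Inr d\<close>, so the marginal integral is the one-coordinate integral of a Gaussian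
    density.\<close>
  have marginal: "(\<lambda>(x, v). LINT t|lborel. q (x, v(d := t))) = qm"
  proof
    fix w :: "(real ^ 'd) \<times> (real ^ 'd \<Rightarrow> real)"
    obtain x v where w: "w = (x, v)" by (cases w)
    have "joint_coord (x, v(d := t)) = (joint_coord (x, v))(Inr d := t)" for t
      by (auto simp: joint_coord_def fun_eq_iff split: sum.split)
    then show "(\<lambda>(x, v). LINT t|lborel. q (x, v(d := t))) w = qm w"
      using integral_gaussian_density_snoc[OF js(3), of m "joint_coord (x, v)"] js(1) by (simp add: w q qm_def)
  qed
  obtain C where C: "\<And>q'. is_gaussian ls q' \<Longrightarrow> KL (joint_law K (d # ls) q) (joint_law K ls q') =
      ereal (C - (\<integral>w. ln (q' w) \<partial>joint_law K (d # ls) q))"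
    using KL_joint_law_Cons[OF assms(4,5)] by blast
  have gibbs: "(\<integral>w. ln (q' w) \<partial>joint_law K (d # ls) q) \<le> (\<integral>w. ln (qm w) \<partial>joint_law K (d # ls) q)"
    "(\<integral>w. ln (q' w) \<partial>joint_law K (d # ls) q) = (\<integral>w. ln (qm w) \<partial>joint_law K (d # ls) q) \<Longrightarrow> q' = qm"
    if "is_gaussian ls q'" for q'
    using gibbs_is_gaussian[OF assms(4) js q that] unfolding qm_def by blast+
  have "is_arg_min (\<lambda>q'. KL (joint_law K (d # ls) q) (joint_law K ls q')) (is_gaussian ls) q' \<longleftrightarrow> q' = qm" for q'
  proof
    assume min: "is_arg_min (\<lambda>q'. KL (joint_law K (d # ls) q) (joint_law K ls q')) (is_gaussian ls) q'"
    then have q': "is_gaussian ls q'" by (simp add: is_arg_min_def)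
    \<comment> \<open>Minimality against \<open>qm\<close> gives the inequality opposite to Gibbs',
      hence the equality case.\<close>
    have "\<not> KL (joint_law K (d # ls) q) (joint_law K ls qm) < KL (joint_law K (d # ls) q) (joint_law K ls q')"
      using min qm by (auto simp: is_arg_min_def)
    then show "q' = qm" using gibbs[OF q'] by (simp add: C[OF q'] C[OF qm])
  next
    assume "q' = qm"
    then show "is_arg_min (\<lambda>q'. KL (joint_law K (d # ls) q) (joint_law K ls q')) (is_gaussian ls) q'"
      using qm gibbs(1) by (auto simp: is_arg_min_def C not_less)
  qed
  then show ?thesis unfolding marginal by simp
qed

end
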